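(* For every skew shape $\lambda/\mu$ with $n=|\lambda/\mu|$ cells, $$F(\lambda/\mu)\ \le\ e(\lambda/\mu)\ \le\ \xi(\lambda/\mu)\,F(\lambda/\mu),\qquad\text{where}\qquad F(\lambda/\mu)=n!\prod_{u\in\lambda/\mu}\frac{1}{h(u)}.$$
   Context: $e(\lambda/\mu)$ is the number of standard Young tableaux of skew shape $\lambda/\mu$. For a cell $u=(i,j)$ (row $i$, column $j$) of the partition $\lambda$, $h(u)=\lambda_i-i+\lambda'_j-j+1$ is the usual hook-length of $u$ in $\lambda$ (where $\lambda'$ is the conjugate partition); the product is over cells of $\lambda$ not in $\mu$. Excited diagrams: let $D$ be a subset of the Young diagram of $\lambda$. A cell $(i,j)\in D$ is active if $(i+1,j)$, $(i,j+1)$ and $(i+1,j+1)$ are all in $\lambda\setminus D$. An excited move replaces an active cell $(i,j)$ of $D$ by $(i+1,j+1)$. An excited diagram of $\lambda/\mu$ is a subset of cells of $\lambda$ obtained from the Young diagram of $\mu$ by a (possibly empty) sequence of excited moves. $\xi(\lambda/\mu)$ denotes the number of excited diagrams of $\lambda/\mu$. *)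

theory Defs
  imports Complex_Main "HOL-Library.FuncSet"
begin

text \<open>
  A partition is the list of its positive parts in weakly decreasing order. Rows and columns
  of diagrams are numbered from 1, and a cell \<open>(i, j)\<close> lies in row \<open>i\<close> and column \<open>j\<close>.
\<close>

definition is_partition :: "nat list \<Rightarrow> bool" where
  "is_partition la \<longleftrightarrow> sorted_wrt (\<ge>) la \<and> (\<forall>p\<in>set la. 0 < p)"

text \<open>\<open>part la i\<close> is the part of index \<open>i\<close>, with the usual value 0 beyond the last part.\<close>

definition part :: "nat list \<Rightarrow> nat \<Rightarrow> nat" where
  "part la i = (if 1 \<le> i \<and> i \<le> length la then la ! (i - 1) else 0)"

definition young_diagram :: "nat list \<Rightarrow> (nat \<times> nat) set" where
  "young_diagram la = {(i, j). 1 \<le> i \<and> 1 \<le> j \<and> j \<le> part la i}"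

text \<open>The parts of the conjugate partition are the column lengths of the diagram.\<close>

definition conj_part :: "nat list \<Rightarrow> nat \<Rightarrow> nat" where
  "conj_part la j = card {i. (i, j) \<in> young_diagram la}"

definition is_skew_shape :: "nat list \<Rightarrow> nat list \<Rightarrow> bool" where
  "is_skew_shape la mu \<longleftrightarrow>
     is_partition la \<and> is_partition mu \<and> young_diagram mu \<subseteq> young_diagram la"

definition skew_diagram :: "nat list \<Rightarrow> nat list \<Rightarrow> (nat \<times> nat) set" where
  "skew_diagram la mu = young_diagram la - young_diagram mu"

fun hook_length :: "nat list \<Rightarrow> nat \<times> nat \<Rightarrow> int" where
  "hook_length la (i, j) = int (part la i) - int i + int (conj_part la j) - int j + 1"

text \<open>
  Tableaux are functions on the cells, made \<open>undefined\<close> elsewhere (by the extensional function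
  space) so that the set of tableaux can be counted.
\<close>

definition standard_tableaux :: "nat list \<Rightarrow> nat list \<Rightarrow> (nat \<times> nat \<Rightarrow> nat) set" where
  "standard_tableaux la mu =
     {T \<in> skew_diagram la mu \<rightarrow>\<^sub>E {1..card (skew_diagram la mu)}.
        bij_betw T (skew_diagram la mu) {1..card (skew_diagram la mu)} \<and>
        (\<forall>i j j'. (i, j) \<in> skew_diagram la mu \<and> (i, j') \<in> skew_diagram la mu \<and> j < j'
                    \<longrightarrow> T (i, j) < T (i, j')) \<and>
        (\<forall>i i' j. (i, j) \<in> skew_diagram la mu \<and> (i', j) \<in> skew_diagram la mu \<and> i < i'
                    \<longrightarrow> T (i, j) < T (i', j))}"

definition num_tableaux :: "nat list \<Rightarrow> nat list \<Rightarrow> nat" where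
  "num_tableaux la mu = card (standard_tableaux la mu)"

definition active :: "nat list \<Rightarrow> (nat \<times> nat) set \<Rightarrow> nat \<times> nat \<Rightarrow> bool" where
  "active la D = (\<lambda>(i, j). (i, j) \<in> D \<and>
     {(i + 1, j), (i, j + 1), (i + 1, j + 1)} \<subseteq> young_diagram la - D)"

definition excited_move :: "nat list \<Rightarrow> (nat \<times> nat) set \<Rightarrow> (nat \<times> nat) set \<Rightarrow> bool" where
  "excited_move la D D' \<longleftrightarrow>
     (\<exists>i j. active la D (i, j) \<and> D' = insert (i + 1, j + 1) (D - {(i, j)}))"

definition excited_diagrams :: "nat list \<Rightarrow> nat list \<Rightarrow> (nat \<times> nat) set set" where
  "excited_diagrams la mu = {D. (excited_move la)\<^sup>*\<^sup>* (young_diagram mu) D}"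

definition num_excited :: "nat list \<Rightarrow> nat list \<Rightarrow> nat" where
  "num_excited la mu = card (excited_diagrams la mu)"

definition F_skew :: "nat list \<Rightarrow> nat list \<Rightarrow> real" where
  "F_skew la mu = fact (card (skew_diagram la mu)) *
     (\<Prod>u\<in>skew_diagram la mu. 1 / of_int (hook_length la u))"

end

theory Submission
  imports Defs
begin

text \<open>
  Both bounds follow from Naruse's formula, which says that \<open>e(\<lambda>/\<mu>) / n!\<close> is the sum, over the
  excited diagrams \<open>D\<close>, of the products of \<open>1 / h(u)\<close> over the cells \<open>u\<close> of \<open>\<lambda>\<close> outside \<open>D\<close>. The
  diagram \<open>D = \<mu>\<close> contributes \<open>F(\<lambda>/\<mu>) / n!\<close>, and since excited moves replace hooks by
  shorter ones, no other term is larger.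

  Removing the cell with entry 1 gives \<open>e(\<lambda>/\<mu>) = \<Sum> e(\<lambda>/\<nu>)\<close>, the sum running over the \<open>\<nu>\<close> that
  add one cell to \<open>\<mu>\<close>. To see that the sum over excited diagrams satisfies the matching recursion,
  build \<open>\<lambda>\<close> cell by cell and apply to the empty diagram, for each cell \<open>u\<close> of content \<open>k\<close>, the
  operator \<open>1 + h(u) F\<^sub>k\<close>, where \<open>F\<^sub>k\<close> adds a cell of content \<open>k\<close>. The coefficient of \<open>\<mu>\<close> in the
  result is the sum over excited diagrams of the products of \<open>h(u)\<close> over \<open>D\<close>. The recursion says
  that the result is an eigenvector, and it is proved by induction on \<open>\<lambda>\<close> with the hook lengths
  generalised to a family of weights on which the removal of a corner acts by a transposition.
\<close>

subsection \<open>Diagrams and their corners\<close>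

type_synonym cell = "nat \<times> nat"

text \<open>Diagrams are finite order ideals of cells, so that adding and removing a cell are plain
  set operations. Lists of parts return only when the definitions of the theorem are
  translated.\<close>

definition is_diagram :: "cell set \<Rightarrow> bool" where
  "is_diagram M \<longleftrightarrow> finite M \<and> (\<forall>(i, j)\<in>M. 1 \<le> i \<and> 1 \<le> j) \<and>
     (\<forall>i j i' j'. (i, j) \<in> M \<longrightarrow> 1 \<le> i' \<longrightarrow> i' \<le> i \<longrightarrow> 1 \<le> j' \<longrightarrow> j' \<le> j \<longrightarrow> (i', j') \<in> M)"

definition addable :: "cell set \<Rightarrow> cell set" where
  "addable M = {a. a \<notin> M \<and> is_diagram (insert a M)}"

definition removable :: "cell set \<Rightarrow> cell set" where
  "removable M = {b \<in> M. is_diagram (M - {b})}"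

definition content :: "cell \<Rightarrow> int" where
  "content u = int (snd u) - int (fst u)"

definition addable_at :: "int \<Rightarrow> cell set \<Rightarrow> cell set" where
  "addable_at k M = {a \<in> addable M. content a = k}"

definition removable_at :: "int \<Rightarrow> cell set \<Rightarrow> cell set" where
  "removable_at k M = {b \<in> removable M. content b = k}"

lemma content_pair [simp]: "content (i, j) = int j - int i"
  by (simp add: content_def)

lemma is_diagram_empty [simp]: "is_diagram {}"
  by (simp add: is_diagram_def)

lemma is_diagramI:
  assumes "finite M" "\<And>i j. (i, j) \<in> M \<Longrightarrow> 1 \<le> i \<and> 1 \<le> j"
    "\<And>i j i' j'. (i, j) \<in> M \<Longrightarrow> 1 \<le> i' \<Longrightarrow> i' \<le> i \<Longrightarrow> 1 \<le> j' \<Longrightarrow> j' \<le> j \<Longrightarrow> (i', j') \<in> M"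
  shows "is_diagram M"
  using assms unfolding is_diagram_def by blast

lemma is_diagram_finite: "is_diagram M \<Longrightarrow> finite M"
  by (simp add: is_diagram_def)

lemma is_diagram_pos: "is_diagram M \<Longrightarrow> (i, j) \<in> M \<Longrightarrow> 1 \<le> i \<and> 1 \<le> j"
  by (auto simp: is_diagram_def)

lemma is_diagram_down:
  "is_diagram M \<Longrightarrow> (i, j) \<in> M \<Longrightarrow> 1 \<le> i' \<Longrightarrow> i' \<le> i \<Longrightarrow> 1 \<le> j' \<Longrightarrow> j' \<le> j \<Longrightarrow> (i', j') \<in> M"
  unfolding is_diagram_def by blast

lemma is_diagram_Int: "is_diagram M \<Longrightarrow> is_diagram M' \<Longrightarrow> is_diagram (M \<inter> M')"
  unfolding is_diagram_def by blast

lemma is_diagram_Un: "is_diagram M \<Longrightarrow> is_diagram M' \<Longrightarrow> is_diagram (M \<union> M')"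
  unfolding is_diagram_def by blast

text \<open>Two neighbours suffice: every cell weakly northwest of \<open>(i, j)\<close> other than
  \<open>(i, j)\<close> itself is weakly northwest of \<open>(i - 1, j)\<close> or of
  \<open>(i, j - 1)\<close>.\<close>

lemma addable_iff:
  assumes "is_diagram M"
  shows "(i, j) \<in> addable M \<longleftrightarrow> (i, j) \<notin> M \<and> 1 \<le> i \<and> 1 \<le> j \<and>
    (1 < i \<longrightarrow> (i - 1, j) \<in> M) \<and> (1 < j \<longrightarrow> (i, j - 1) \<in> M)" (is "?L \<longleftrightarrow> ?R")
proof
  assume ?L
  then have n: "(i, j) \<notin> M" and d: "is_diagram (insert (i, j) M)" by (auto simp: addable_def)
  have "1 \<le> i \<and> 1 \<le> j" using is_diagram_pos[OF d] by blast
  moreover have "(i - 1, j) \<in> insert (i, j) M" if "1 < i"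
    by (rule is_diagram_down[OF d, of i j]) (use that calculation in auto)
  moreover have "(i, j - 1) \<in> insert (i, j) M" if "1 < j"
    by (rule is_diagram_down[OF d, of i j]) (use that calculation in auto)
  ultimately show ?R using n by auto
next
  assume R: ?R
  have new: "(i', j') \<in> insert (i, j) M" if "1 \<le> i'" "i' \<le> i" "1 \<le> j'" "j' \<le> j" for i' j'
  proof -
    have "i' = i \<and> j' = j \<or> i' < i \<or> j' < j" using that by auto
    then consider "i' = i \<and> j' = j" | "i' < i" | "j' < j" by blast
    then show ?thesis
    proof cases
      case 2
      then have "(i - 1, j) \<in> M" using R that by linarith
      then show ?thesis using is_diagram_down[OF assms, of "i - 1" j i' j'] 2 that by auto
    next
      case 3
      then have "(i, j - 1) \<in> M" using R that by linarith
      then show ?thesis using is_diagram_down[OF assms, of i "j - 1" i' j'] 3 that by auto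
    qed simp
  qed
  have "is_diagram (insert (i, j) M)"
  proof (rule is_diagramI)
    fix i1 j1 i2 j2
    assume a: "(i1, j1) \<in> insert (i, j) M" "1 \<le> i2" "i2 \<le> i1" "1 \<le> j2" "j2 \<le> j1"
    show "(i2, j2) \<in> insert (i, j) M"
    proof (cases "(i1, j1) = (i, j)")
      case True
      then show ?thesis using new a by simp
    next
      case False
      then show ?thesis using is_diagram_down[OF assms _ a(2-5)] a(1) by blast
    qed
  qed (use R is_diagram_finite[OF assms] is_diagram_pos[OF assms] in auto)
  then show ?L using R by (simp add: addable_def)
qed

text \<open>Any other cell of \<open>M\<close> weakly southeast of \<open>(i, j)\<close> would force
  \<open>(i + 1, j)\<close> or \<open>(i, j + 1)\<close> into \<open>M\<close>.\<close>

lemma removable_iff: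
  assumes "is_diagram M"
  shows "(i, j) \<in> removable M \<longleftrightarrow> (i, j) \<in> M \<and> (i + 1, j) \<notin> M \<and> (i, j + 1) \<notin> M" (is "?L \<longleftrightarrow> ?R")
proof
  assume ?L
  then have m: "(i, j) \<in> M" and d: "is_diagram (M - {(i, j)})" by (auto simp: removable_def)
  have p: "1 \<le> i \<and> 1 \<le> j" using is_diagram_pos[OF assms m] .
  have "(i + 1, j) \<notin> M"
    using is_diagram_down[OF d, of "i + 1" j i j] p by auto
  moreover have "(i, j + 1) \<notin> M"
    using is_diagram_down[OF d, of i "j + 1" i j] p by auto
  ultimately show ?R using m by auto
next
  assume R: ?R
  have p: "1 \<le> i \<and> 1 \<le> j" using is_diagram_pos[OF assms] R by blast
  have top: "i' = i \<and> j' = j" if "(i', j') \<in> M" "i \<le> i'" "j \<le> j'" for i' j'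
  proof (rule ccontr)
    assume "\<not> (i' = i \<and> j' = j)"
    then have "i + 1 \<le> i' \<or> j + 1 \<le> j'" using that(2,3) by auto
    then consider "i + 1 \<le> i'" | "j + 1 \<le> j'" by blast
    then show False
      using is_diagram_down[OF assms that(1), of "i + 1" j]
        is_diagram_down[OF assms that(1), of i "j + 1"] R p that by cases auto
  qed
  have "is_diagram (M - {(i, j)})"
  proof (rule is_diagramI)
    fix i1 j1 i2 j2 assume a: "(i1, j1) \<in> M - {(i, j)}" "1 \<le> i2" "i2 \<le> i1" "1 \<le> j2" "j2 \<le> j1"
    have "(i2, j2) \<in> M" using is_diagram_down[OF assms _ a(2-5)] a(1) by blast
    moreover have "(i2, j2) \<noteq> (i, j)" using top[of i1 j1] a by blast
    ultimately show "(i2, j2) \<in> M - {(i, j)}" by blast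
  qed (use is_diagram_finite[OF assms] is_diagram_pos[OF assms] in blast)+
  then show ?L using R by (simp add: removable_def)
qed

section \<open>Diagonal lengths determine a diagram and its corners\<close>

definition diag_cell :: "int \<Rightarrow> nat \<Rightarrow> cell" where
  "diag_cell k s = (s + nat (- k), s + nat k)"

definition diag_len :: "cell set \<Rightarrow> int \<Rightarrow> nat" where
  "diag_len M k = card {u \<in> M. content u = k}"

lemma down_closed_eq_atLeastAtMost:
  fixes X :: "nat set"
  assumes "finite X" "\<And>s. s \<in> X \<Longrightarrow> 1 \<le> s" "\<And>s s'. s \<in> X \<Longrightarrow> 1 \<le> s' \<Longrightarrow> s' \<le> s \<Longrightarrow> s' \<in> X"
  shows "X = {1..card X}"
proof (cases "X = {}")
  case False
  have eq: "X = {1..Max X}"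
  proof (rule set_eqI)
    fix s
    have "s \<in> X \<longleftrightarrow> 1 \<le> s \<and> s \<le> Max X"
      using Max_ge[OF assms(1)] assms(2) assms(3)[OF Max_in[OF assms(1) False]] by blast
    then show "s \<in> X \<longleftrightarrow> s \<in> {1..Max X}" by (simp only: atLeastAtMost_iff)
  qed
  have "card X = Max X" using arg_cong[OF eq, of card] by simp
  then have "{1..card X} = {1..Max X}" by simp
  then show ?thesis by (rule trans[OF eq sym])
qed simp

text \<open>A diagram meets each diagonal in an initial segment, and \<open>min i j\<close> is the
  position of \<open>(i, j)\<close> on its diagonal, counted from 1.\<close>

lemma mem_iff_diag_len:
  assumes "is_diagram M" "1 \<le> i" "1 \<le> j"
  shows "(i, j) \<in> M \<longleftrightarrow> min i j \<le> diag_len M (int j - int i)"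
proof -
  define k where "k = int j - int i"
  define X where "X = {s. 1 \<le> s \<and> diag_cell k s \<in> M}"
  have ij: "(i, j) = diag_cell k (min i j)"
    using assms by (auto simp: diag_cell_def k_def min_def)
  have inj: "inj (diag_cell k)"
    by (auto simp: inj_def diag_cell_def)
  have img: "{u \<in> M. content u = k} = diag_cell k ` X"
  proof (intro equalityI subsetI)
    fix u assume u: "u \<in> {u \<in> M. content u = k}"
    obtain a b where ab: "u = (a, b)" by (cases u)
    have "1 \<le> a \<and> 1 \<le> b" using is_diagram_pos[OF assms(1)] u ab by blast
    then have "u = diag_cell k (min a b)" "1 \<le> min a b"
      using u ab by (auto simp: diag_cell_def min_def)
    then show "u \<in> diag_cell k ` X" using u by (auto simp: X_def)
  qed (auto simp: X_def diag_cell_def)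
  have fX: "finite X"
    using finite_subset[of "diag_cell k ` X" M] is_diagram_finite[OF assms(1)]
      finite_imageD[OF _ inj_on_subset[OF inj]] by (auto simp: X_def)
  have down: "s' \<in> X" if "s \<in> X" "1 \<le> s'" "s' \<le> s" for s s'
    using that is_diagram_down[OF assms(1), of "s + nat (-k)" "s + nat k" "s' + nat (-k)" "s' + nat k"]
    by (auto simp: X_def diag_cell_def)
  have X: "X = {1..card X}"
    by (rule down_closed_eq_atLeastAtMost[OF fX _ down]) (simp add: X_def)
  have len: "diag_len M k = card X"
    unfolding diag_len_def img by (rule card_image) (rule inj_on_subset[OF inj], simp)
  have "min i j \<in> X \<longleftrightarrow> min i j \<in> {1..card X}"
    using X by (rule arg_cong)
  then show ?thesis
    using assms(2,3) ij len by (simp add: k_def[symmetric]) (simp add: X_def)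
qed

lemma diag_cell_mem_iff:
  assumes "is_diagram M" "1 \<le> s"
  shows "diag_cell k s \<in> M \<longleftrightarrow> s \<le> diag_len M k"
proof -
  have "int (s + nat k) - int (s + nat (- k)) = k" "min (s + nat (- k)) (s + nat k) = s"
    by (cases "0 \<le> k"; simp)+
  then show ?thesis
    unfolding diag_cell_def by (subst mem_iff_diag_len) (use assms in auto)
qed

text \<open>The upper neighbour of the last cell of diagonal \<open>k - 1\<close> lies on diagonal
  \<open>k\<close>, and the left neighbour of the last cell of diagonal \<open>k\<close> lies on
  diagonal \<open>k - 1\<close>. The correction 1 appears when this step lowers the smaller
  coordinate; the position must then be at least 2 for the neighbour to exist.\<close>

lemma diag_len_step:
  assumes M: "is_diagram M"
  shows "diag_len M (k - 1) \<le> diag_len M k + (if 1 \<le> k then 1 else 0)" (is ?A)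
    and "diag_len M k \<le> diag_len M (k - 1) + (if k \<le> 0 then 1 else 0)" (is ?B)
proof -
  have mem: "1 \<le> diag_len M l \<Longrightarrow> diag_cell l (diag_len M l) \<in> M" for l
    using diag_cell_mem_iff[OF M] by blast
  show ?A
  proof (cases "1 \<le> k")
    case k: True
    define s where "s = diag_len M (k - 1)"
    show ?thesis
    proof (cases "2 \<le> s")
      case True
      have "diag_cell k (s - 1) \<in> M"
        using mem[of "k - 1"] k True unfolding s_def[symmetric] diag_cell_def
        by (auto intro: is_diagram_down[OF M])
      then have "s - 1 \<le> diag_len M k"
        using diag_cell_mem_iff[OF M, of "s - 1" k] True by simp
      then show ?thesis using True k s_def by simp
    qed (use k s_def in auto)
  next
    case k: False
    define s where "s = diag_len M (k - 1)"
    show ?thesis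
    proof (cases "1 \<le> s")
      case True
      have "diag_cell k s \<in> M"
        using mem[of "k - 1"] k True unfolding s_def[symmetric] diag_cell_def
        by (auto intro: is_diagram_down[OF M])
      then have "s \<le> diag_len M k"
        using diag_cell_mem_iff[OF M, of s k] True by simp
      then show ?thesis using True k s_def by simp
    qed (use k s_def in auto)
  qed
  show ?B
  proof (cases "1 \<le> k")
    case k: True
    define s where "s = diag_len M k"
    show ?thesis
    proof (cases "1 \<le> s")
      case True
      have "diag_cell (k - 1) s \<in> M"
        using mem[of k] k True unfolding s_def[symmetric] diag_cell_def
        by (auto intro: is_diagram_down[OF M])
      then have "s \<le> diag_len M (k - 1)"
        using diag_cell_mem_iff[OF M, of s "k - 1"] True by simp
      then show ?thesis using True k s_def by simp
    qed (use k s_def in auto)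
  next
    case k: False
    define s where "s = diag_len M k"
    show ?thesis
    proof (cases "2 \<le> s")
      case True
      have "diag_cell (k - 1) (s - 1) \<in> M"
        using mem[of k] k True unfolding s_def[symmetric] diag_cell_def
        by (auto intro: is_diagram_down[OF M])
      then have "s - 1 \<le> diag_len M (k - 1)"
        using diag_cell_mem_iff[OF M, of "s - 1" "k - 1"] True by simp
      then show ?thesis using True k s_def by simp
    qed (use k s_def in auto)
  qed
qed

lemma diag_len_bounds:
  assumes "is_diagram M"
  shows "diag_len M (k - 1) \<le> diag_len M k + (if 1 \<le> k then 1 else 0)"
    and "diag_len M (k + 1) \<le> diag_len M k + (if k \<le> - 1 then 1 else 0)"
    and "diag_len M k \<le> diag_len M (k + 1) + (if 0 \<le> k then 1 else 0)"
    and "diag_len M k \<le> diag_len M (k - 1) + (if k \<le> 0 then 1 else 0)"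
  using diag_len_step[OF assms, of k] diag_len_step[OF assms, of "k + 1"]
  by (auto simp del: One_nat_def split: if_splits)

lemma diag_cell_eq_iff: "(i, j) = diag_cell k s \<longleftrightarrow> int j - int i = k \<and> min i j = s"
  by (cases "0 \<le> k") (auto simp: diag_cell_def min_def)

text \<open>A new cell is the first free one on its diagonal and needs its upper and left neighbours
  in \<open>M\<close>. Since the lengths of the adjacent diagonals are bounded above, this means
  that both bounds are attained. In particular a diagonal carries at most one addable cell.\<close>

lemma addable_at_eq:
  assumes M: "is_diagram M"
  shows "addable_at k M =
    (if diag_len M (k - 1) = diag_len M k + (if 1 \<le> k then 1 else 0) \<and>
        diag_len M (k + 1) = diag_len M k + (if k \<le> - 1 then 1 else 0)
     then {diag_cell k (diag_len M k + 1)} else {})"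
proof -
  note b = diag_len_bounds[OF M, of k]
  have *: "(i, j) \<in> addable_at k M \<longleftrightarrow> 1 \<le> i \<and> 1 \<le> j \<and> int j - int i = k \<and> min i j = diag_len M k + 1 \<and>
      (diag_len M (k - 1) = diag_len M k + (if 1 \<le> k then 1 else 0) \<and>
        diag_len M (k + 1) = diag_len M k + (if k \<le> - 1 then 1 else 0))" (is "_ \<longleftrightarrow> ?R") for i j
  proof (cases "1 \<le> i \<and> 1 \<le> j \<and> int j - int i = k")
    case True
    have 1: "1 < i \<Longrightarrow> (i - 1, j) \<in> M \<longleftrightarrow> min (i - 1) j \<le> diag_len M (k + 1)"
      using mem_iff_diag_len[OF M, of "i - 1" j] True by (simp add: of_nat_diff algebra_simps)
    have 2: "1 < j \<Longrightarrow> (i, j - 1) \<in> M \<longleftrightarrow> min i (j - 1) \<le> diag_len M (k - 1)"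
      using mem_iff_diag_len[OF M, of i "j - 1"] True by (simp add: of_nat_diff algebra_simps)
    have "(i, j) \<in> addable_at k M \<longleftrightarrow> \<not> min i j \<le> diag_len M k \<and>
      (1 < i \<longrightarrow> min (i - 1) j \<le> diag_len M (k + 1)) \<and> (1 < j \<longrightarrow> min i (j - 1) \<le> diag_len M (k - 1))"
      unfolding addable_at_def mem_Collect_eq addable_iff[OF M] content_pair
      using True 1 2 mem_iff_diag_len[OF M, of i j] by auto
    also have "\<dots> \<longleftrightarrow> ?R"
    proof -
      consider "1 \<le> k" | "k = 0" | "k \<le> -1" by linarith
      then show ?thesis
      proof cases
        case 1
        then have "min i j = i" "min (i - 1) j = i - 1" "min i (j - 1) = i" "j > 1" using True by auto
        then show ?thesis using 1 True b by auto
      next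
        case 2
        then have "i = j" using True by auto
        then show ?thesis using 2 True b by auto
      next
        case 3
        then have "min i j = j" "min (i - 1) j = j" "min i (j - 1) = j - 1" "i > 1" using True by auto
        then show ?thesis using 3 True b by auto
      qed
    qed
    finally show ?thesis .
  next
    case False
    then show ?thesis unfolding addable_at_def mem_Collect_eq addable_iff[OF M] content_pair by auto
  qed
  show ?thesis
  proof (rule set_eqI)
    fix u show "u \<in> addable_at k M \<longleftrightarrow> u \<in> (if diag_len M (k - 1) = diag_len M k + (if 1 \<le> k then 1 else 0) \<and>
        diag_len M (k + 1) = diag_len M k + (if k \<le> - 1 then 1 else 0)
      then {diag_cell k (diag_len M k + 1)} else {})"
      by (cases u) (simp only: * diag_cell_eq_iff if_distrib[of "\<lambda>X. _ \<in> X"] singleton_iff empty_iff, auto)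
  qed
qed

text \<open>Dually, the last cell of a diagonal is removable when its lower and right neighbours are
  missing, that is, when the adjacent diagonals are as short as the bounds allow.\<close>

lemma removable_at_eq:
  assumes M: "is_diagram M"
  shows "removable_at k M =
    (if diag_len M k = diag_len M (k - 1) + (if k \<le> 0 then 1 else 0) \<and>
        diag_len M k = diag_len M (k + 1) + (if 0 \<le> k then 1 else 0)
     then {diag_cell k (diag_len M k)} else {})"
proof -
  note b = diag_len_bounds[OF M, of k]
  have *: "(i, j) \<in> removable_at k M \<longleftrightarrow> int j - int i = k \<and> min i j = diag_len M k \<and>
      (diag_len M k = diag_len M (k - 1) + (if k \<le> 0 then 1 else 0) \<and>
        diag_len M k = diag_len M (k + 1) + (if 0 \<le> k then 1 else 0))" (is "_ \<longleftrightarrow> ?R") for i j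
  proof (cases "1 \<le> i \<and> 1 \<le> j \<and> int j - int i = k")
    case True
    have 1: "(i + 1, j) \<in> M \<longleftrightarrow> min (i + 1) j \<le> diag_len M (k - 1)"
      using mem_iff_diag_len[OF M, of "i + 1" j] True by (simp add: algebra_simps)
    have 2: "(i, j + 1) \<in> M \<longleftrightarrow> min i (j + 1) \<le> diag_len M (k + 1)"
      using mem_iff_diag_len[OF M, of i "j + 1"] True by (simp add: algebra_simps)
    have "(i, j) \<in> removable_at k M \<longleftrightarrow> min i j \<le> diag_len M k \<and>
      \<not> min (i + 1) j \<le> diag_len M (k - 1) \<and> \<not> min i (j + 1) \<le> diag_len M (k + 1)"
      unfolding removable_at_def mem_Collect_eq removable_iff[OF M] content_pair
      using True 1 2 mem_iff_diag_len[OF M, of i j] by auto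
    also have "\<dots> \<longleftrightarrow> ?R"
    proof -
      consider "1 \<le> k" | "k = 0" | "k \<le> -1" by linarith
      then show ?thesis
      proof cases
        case 1
        then have "min i j = i" "min (i + 1) j = i + 1" "min i (j + 1) = i" using True by auto
        then show ?thesis using 1 True b by auto
      next
        case 2
        then have "i = j" using True by auto
        then show ?thesis using 2 True b by auto
      next
        case 3
        then have "min i j = j" "min (i + 1) j = j" "min i (j + 1) = j + 1" using True by auto
        then show ?thesis using 3 True b by auto
      qed
    qed
    finally show ?thesis .
  next
    case False
    have "(i, j) \<notin> removable_at k M"
      using False is_diagram_pos[OF M, of i j] by (auto simp: removable_at_def removable_def)
    moreover have "\<not> ?R"
    proof
      assume R: ?R
      \<comment> \<open>For every \<open>k\<close> at least one of the two corrections equals 1, so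
        the diagonal is nonempty and \<open>i\<close> and \<open>j\<close> are positive.\<close>
      then have "1 \<le> diag_len M k" by (auto split: if_splits)
      then show False using False R by auto
    qed
    ultimately show ?thesis by blast
  qed
  show ?thesis
  proof (rule set_eqI)
    fix u show "u \<in> removable_at k M \<longleftrightarrow> u \<in> (if diag_len M k = diag_len M (k - 1) + (if k \<le> 0 then 1 else 0) \<and>
        diag_len M k = diag_len M (k + 1) + (if 0 \<le> k then 1 else 0)
      then {diag_cell k (diag_len M k)} else {})"
      by (cases u) (simp only: * diag_cell_eq_iff if_distrib[of "\<lambda>X. _ \<in> X"] singleton_iff empty_iff, auto)
  qed
qed

lemma sum_content_delta:
  assumes "finite M"
  shows "(\<Sum>u\<in>M. if content u = k then x else 0 :: real) = x * real (diag_len M k)"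
proof -
  have "(\<Sum>u\<in>M. if content u = k then x else 0) = (\<Sum>u\<in>{u \<in> M. content u = k}. x)"
    by (rule sum.inter_filter[symmetric]) (rule assms)
  then show ?thesis by (simp add: diag_len_def)
qed

text \<open>
  Consecutive diagonals have lengths that differ by at most one, and the two differences around
  diagonal \<open>k\<close> decide whether it carries an addable or a removable cell.
\<close>

lemma corner_balance:
  assumes M: "is_diagram M"
  shows "real (diag_len M (k - 1)) + real (diag_len M (k + 1)) - 2 * real (diag_len M k) =
    real (card (addable_at k M)) - real (card (removable_at k M)) - (if k = 0 then 1 else 0)"
proof -
  note b = diag_len_bounds[OF M, of k]
  \<comment> \<open>Off the main diagonal the second difference lies in {-1, 0, 1}. The neighbours
    of the main diagonal are never longer than it, so there the range is {-2, -1, 0}; hence the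
    shift by 1 at \<open>k = 0\<close>.\<close>
  consider "1 \<le> k" | "k = 0" | "k \<le> -1" by linarith
  then show ?thesis
    unfolding addable_at_eq[OF M] removable_at_eq[OF M]
    using b by cases auto
qed

lemma removable_at_singleton:
  assumes "is_diagram M" "b \<in> removable_at k M"
  shows "removable_at k M = {b}" "addable_at k M = {}"
  using assms(2) unfolding removable_at_eq[OF assms(1)] addable_at_eq[OF assms(1)]
  by (auto split: if_splits)

subsection \<open>Adding and removing cells\<close>

lemma addable_is_diagram: "a \<in> addable M \<Longrightarrow> is_diagram (insert a M)"
  by (simp add: addable_def)

lemma removable_is_diagram: "b \<in> removable_at k M \<Longrightarrow> is_diagram (M - {b})"
  by (simp add: removable_at_def removable_def)

lemma finite_addable:
  assumes M: "is_diagram M"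
  shows "finite (addable M)"
proof (rule finite_subset)
  show "addable M \<subseteq> insert (1, 1) ((\<lambda>(i, j). (i + 1, j)) ` M \<union> (\<lambda>(i, j). (i, j + 1)) ` M)"
  proof
    fix a assume "a \<in> addable M"
    moreover obtain i j where a: "a = (i, j)" by (cases a)
    ultimately have *: "1 \<le> i" "1 \<le> j" "1 < i \<longrightarrow> (i - 1, j) \<in> M" "1 < j \<longrightarrow> (i, j - 1) \<in> M"
      using addable_iff[OF M] by auto
    consider "1 < i" | "1 < j" | "i = 1" "j = 1" using * by linarith
    then show "a \<in> insert (1, 1) ((\<lambda>(i, j). (i + 1, j)) ` M \<union> (\<lambda>(i, j). (i, j + 1)) ` M)"
    proof cases
      case 1
      then have "a = (\<lambda>(i, j). (i + 1, j)) (i - 1, j)" by (simp add: a)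
      then show ?thesis using * 1 by blast
    next
      case 2
      then have "a = (\<lambda>(i, j). (i, j + 1)) (i, j - 1)" by (simp add: a)
      then show ?thesis using * 2 by blast
    qed (simp add: a)
  qed
qed (use is_diagram_finite[OF M] in simp)

lemma finite_removable_at: "is_diagram M \<Longrightarrow> finite (removable_at k M)"
  using finite_subset[of "removable_at k M" M] is_diagram_finite[of M]
  by (auto simp: removable_at_def removable_def)

text \<open>A corner \<open>b\<close> of the enlarged diagram other than \<open>a\<close> was a
  corner before, because \<open>M - {b}\<close> is an intersection of two diagrams.\<close>

lemma removable_at_insert:
  assumes M: "is_diagram M" and a: "a \<in> addable M"
  shows "removable_at k (insert a M) =
    (if content a = k then {a} else {}) \<union> {b \<in> removable_at k M. b \<in> removable (insert a M)}"
proof -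
  have "a \<notin> M" using a by (simp add: addable_def)
  then have "insert a M - {a} = M" by blast
  then have 1: "a \<in> removable (insert a M)" using M by (simp add: removable_def)
  have 2: "b \<in> removable M" if "b \<in> removable (insert a M)" "b \<noteq> a" for b
  proof -
    have "M \<inter> (insert a M - {b}) = M - {b}" by blast
    then have "is_diagram (M - {b})"
      using is_diagram_Int[OF M, of "insert a M - {b}"] that by (simp add: removable_def)
    then show ?thesis using that by (auto simp: removable_def)
  qed
  show ?thesis
    using 1 2 \<open>a \<notin> M\<close> by (auto simp: removable_at_def)
qed

text \<open>The mirror image, with a union in place of the intersection. Both lemmas produce the
  same condition \<open>b \<in> removable (insert a M)\<close>, which is what makes the mixed terms
  of the commutator cancel.\<close>

lemma addable_remove:
  assumes M: "is_diagram M" and b: "b \<in> removable M"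
  shows "addable (M - {b}) = insert b {a \<in> addable M. b \<in> removable (insert a M)}"
proof (intro equalityI subsetI)
  fix a assume a: "a \<in> addable (M - {b})"
  have bM: "b \<in> M" using b by (simp add: removable_def)
  show "a \<in> insert b {a \<in> addable M. b \<in> removable (insert a M)}"
  proof (cases "a = b")
    case False
    then have aM: "a \<notin> M" and d: "is_diagram (insert a (M - {b}))" using a by (auto simp: addable_def)
    have "insert a (M - {b}) \<union> M = insert a M" by blast
    then have "a \<in> addable M" using is_diagram_Un[OF d M] aM by (simp add: addable_def)
    moreover have "insert a M - {b} = insert a (M - {b})" using False by blast
    then have "b \<in> removable (insert a M)" using d bM by (simp add: removable_def)
    ultimately show ?thesis by blast
  qed simp
next
  fix a assume a: "a \<in> insert b {a \<in> addable M. b \<in> removable (insert a M)}"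
  have bM: "b \<in> M" using b by (simp add: removable_def)
  show "a \<in> addable (M - {b})"
  proof (cases "a = b")
    case True
    moreover have "insert b (M - {b}) = M" using bM by blast
    ultimately show ?thesis using M by (simp add: addable_def)
  next
    case False
    then have *: "a \<in> addable M" "b \<in> removable (insert a M)" using a by auto
    have "insert a M - {b} = insert a (M - {b})" using False by blast
    then show ?thesis using * by (auto simp: addable_def removable_def)
  qed
qed

text \<open>The relation \<open>[E, F] = H\<close> of the action of \<open>sl\<^sub>\<infinity>\<close> on partitions.\<close>

lemma add_remove_commutator:
  fixes f :: "cell set \<Rightarrow> real"
  assumes M: "is_diagram M"
  shows "(\<Sum>a\<in>addable M. \<Sum>b\<in>removable_at k (insert a M). f (insert a M - {b})) =
    (\<Sum>b\<in>removable_at k M. \<Sum>a\<in>addable (M - {b}). f (insert a (M - {b}))) +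
    (real (card (addable_at k M)) - real (card (removable_at k M))) * f M"
proof -
  let ?ok = "\<lambda>a b. b \<in> removable (insert a M)"
  have fin: "finite (addable M)" "finite (removable_at k M)"
    using finite_addable[OF M] finite_removable_at[OF M] by auto
  \<comment> \<open>Removing the cell \<open>a\<close> just added gives \<open>f M\<close> back;
    this accounts for the addable cells of content \<open>k\<close>.\<close>
  have inner: "(\<Sum>b\<in>removable_at k (insert a M). f (insert a M - {b})) =
      (if content a = k then f M else 0) +
      (\<Sum>b\<in>removable_at k M. if ?ok a b then f (insert a (M - {b})) else 0)"
    if a: "a \<in> addable M" for a
  proof -
    have aM: "a \<notin> M" using a by (simp add: addable_def)
    have na: "a \<notin> removable_at k M" using aM by (auto simp: removable_at_def removable_def)
    have sub: "insert a M - {b} = insert a (M - {b})" if "b \<in> removable_at k M" for b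
      using that na by blast
    have "(\<Sum>b\<in>removable_at k (insert a M). f (insert a M - {b})) =
        (\<Sum>b\<in>(if content a = k then {a} else {}). f (insert a M - {b})) +
        (\<Sum>b\<in>{b \<in> removable_at k M. ?ok a b}. f (insert a M - {b}))"
      unfolding removable_at_insert[OF M a] using fin na
      by (intro sum.union_disjoint) auto
    also have "(\<Sum>b\<in>(if content a = k then {a} else {}). f (insert a M - {b})) =
        (if content a = k then f M else 0)"
      using aM by simp
    also have "(\<Sum>b\<in>{b \<in> removable_at k M. ?ok a b}. f (insert a M - {b})) =
        (\<Sum>b\<in>removable_at k M. if ?ok a b then f (insert a M - {b}) else 0)"
      by (rule sum.inter_filter[OF fin(2)])
    also have "\<dots> = (\<Sum>b\<in>removable_at k M. if ?ok a b then f (insert a (M - {b})) else 0)"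
      by (intro sum.cong refl) (simp add: sub)
    finally show ?thesis .
  qed
  \<comment> \<open>Adding back the removed cell \<open>b\<close> gives \<open>f M\<close> as well;
    this accounts for the removable cells with the opposite sign.\<close>
  have outer: "(\<Sum>a\<in>addable M. if ?ok a b then f (insert a (M - {b})) else 0) =
      (\<Sum>a\<in>addable (M - {b}). f (insert a (M - {b}))) - f M"
    if b: "b \<in> removable_at k M" for b
  proof -
    have b': "b \<in> removable M" "b \<in> M" using b by (auto simp: removable_at_def removable_def)
    have "b \<notin> {a \<in> addable M. ?ok a b}" using b' by (simp add: addable_def)
    then have "(\<Sum>a\<in>addable (M - {b}). f (insert a (M - {b}))) =
        f (insert b (M - {b})) + (\<Sum>a\<in>{a \<in> addable M. ?ok a b}. f (insert a (M - {b})))"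
      unfolding addable_remove[OF M b'(1)] using fin by (intro sum.insert) auto
    then show ?thesis
      using b'(2) by (simp add: insert_absorb sum.inter_filter[OF fin(1)])
  qed
  have "(\<Sum>a\<in>addable M. if content a = k then f M else 0) = real (card (addable_at k M)) * f M"
    unfolding addable_at_def by (simp add: sum.inter_filter[OF fin(1), symmetric])
  moreover have "(\<Sum>a\<in>addable M. \<Sum>b\<in>removable_at k M. if ?ok a b then f (insert a (M - {b})) else 0) =
      (\<Sum>b\<in>removable_at k M. (\<Sum>a\<in>addable (M - {b}). f (insert a (M - {b}))) - f M)"
    by (subst sum.swap) (simp add: outer)
  ultimately show ?thesis
    by (simp add: inner sum.distrib sum_subtractf algebra_simps)
qed

section \<open>Transposed weights and the eigenvalues of the recursion\<close>

definition swap_at :: "int \<Rightarrow> (int \<Rightarrow> real) \<Rightarrow> int \<Rightarrow> real" where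
  "swap_at k t = t(k := t (k - 1), k - 1 := t k)"

text \<open>Differences of \<open>diag_sum\<close> are the eigenvalues in
  \<open>excited_sum_recursion\<close>. For \<open>t x = - x\<close> every summand is 1 and the sum
  counts the cells.\<close>

definition diag_sum :: "(int \<Rightarrow> real) \<Rightarrow> cell set \<Rightarrow> real" where
  "diag_sum t M = (\<Sum>u\<in>M. t (content u - 1) - t (content u))"

text \<open>With \<open>z = t (k - 1) - t k\<close>, the transposition changes the summands on the
  diagonals \<open>k - 1\<close>, \<open>k\<close>, \<open>k + 1\<close> by \<open>z\<close>,
  \<open>- 2 * z\<close>, \<open>z\<close> and no others, so a second difference of diagonal lengths
  appears and \<open>corner_balance\<close> evaluates it.\<close>

lemma diag_sum_swap:
  assumes M: "is_diagram M"
  shows "diag_sum (swap_at k t) M = diag_sum t M + (t (k - 1) - t k) *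
    (real (card (addable_at k M)) - real (card (removable_at k M)) - (if k = 0 then 1 else 0))"
proof -
  define z where "z = t (k - 1) - t k"
  have "diag_sum (swap_at k t) M = (\<Sum>u\<in>M. (t (content u - 1) - t (content u)) +
      (if content u = k - 1 then z else 0) + (if content u = k + 1 then z else 0) +
      (if content u = k then - 2 * z else 0))"
    unfolding diag_sum_def by (intro sum.cong) (auto simp: swap_at_def z_def)
  also have "\<dots> = diag_sum t M +
      z * (real (diag_len M (k - 1)) + real (diag_len M (k + 1)) - 2 * real (diag_len M k))"
    unfolding sum.distrib sum_content_delta[OF is_diagram_finite[OF M]] diag_sum_def
    by (simp add: algebra_simps)
  finally show ?thesis by (simp add: corner_balance[OF M] z_def)
qed

lemma diag_sum_remove:
  assumes "is_diagram M" "b \<in> M"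
  shows "diag_sum t (M - {b}) = diag_sum t M - (t (content b - 1) - t (content b))"
  unfolding diag_sum_def using assms is_diagram_finite by (simp add: sum_diff1)

text \<open>With one removable and no addable cell on diagonal \<open>k\<close>, the transposition
  contributes \<open>- z\<close> and the removal of \<open>b\<close> contributes \<open>+ z\<close>.
  Only the correction at \<open>k = 0\<close> survives.\<close>

lemma diag_sum_swap_remove:
  assumes M: "is_diagram M" and b: "b \<in> removable_at k M"
  shows "diag_sum (swap_at k t) (M - {b}) = diag_sum t M - (if k = 0 then t (k - 1) - t k else 0)"
proof -
  have "b \<in> M" "content b = k" using b by (auto simp: removable_at_def removable_def)
  moreover have "swap_at k t (k - 1) = t k" "swap_at k t k = t (k - 1)" by (simp_all add: swap_at_def)
  ultimately show ?thesis
    using diag_sum_remove[OF M, of b "swap_at k t"] diag_sum_swap[OF M, of k t]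
      removable_at_singleton[OF M b] by (cases "k = 0") (simp_all add: algebra_simps)
qed

subsection \<open>Hook lengths\<close>

definition row_len :: "cell set \<Rightarrow> nat \<Rightarrow> nat" where
  "row_len L i = card {j. (i, j) \<in> L}"

definition col_len :: "cell set \<Rightarrow> nat \<Rightarrow> nat" where
  "col_len L j = card {i. (i, j) \<in> L}"

lemma mem_iff_row_len:
  assumes L: "is_diagram L" and "1 \<le> i" "1 \<le> j"
  shows "(i, j) \<in> L \<longleftrightarrow> j \<le> row_len L i"
proof -
  have "finite {j. (i, j) \<in> L}"
    by (rule finite_subset[of _ "snd ` L"]) (use is_diagram_finite[OF L] in force)+
  then have "{j. (i, j) \<in> L} = {1..card {j. (i, j) \<in> L}}"
    using is_diagram_pos[OF L] is_diagram_down[OF L] assms(2)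
    by (intro down_closed_eq_atLeastAtMost) blast+
  then have "j \<in> {j. (i, j) \<in> L} \<longleftrightarrow> j \<in> {1..row_len L i}"
    unfolding row_len_def by (rule arg_cong)
  then show ?thesis using assms by simp
qed

lemma mem_iff_col_len:
  assumes L: "is_diagram L" and "1 \<le> i" "1 \<le> j"
  shows "(i, j) \<in> L \<longleftrightarrow> i \<le> col_len L j"
proof -
  have "finite {i. (i, j) \<in> L}"
    by (rule finite_subset[of _ "fst ` L"]) (use is_diagram_finite[OF L] in force)+
  then have "{i. (i, j) \<in> L} = {1..card {i. (i, j) \<in> L}}"
    using is_diagram_pos[OF L] is_diagram_down[OF L] assms(3)
    by (intro down_closed_eq_atLeastAtMost) blast+
  then have "i \<in> {i. (i, j) \<in> L} \<longleftrightarrow> i \<in> {1..col_len L j}"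
    unfolding col_len_def by (rule arg_cong)
  then show ?thesis using assms by simp
qed

text \<open>
  In the Maya diagram of \<open>L\<close>, row \<open>i\<close> has a bead at \<open>row_len L i - i\<close> and column \<open>j\<close> has a hole
  at \<open>j - 1 - col_len L j\<close>. Adding a cell of content \<open>k\<close> moves a bead from \<open>k - 1\<close> to \<open>k\<close>. For
  \<open>t x = - x\<close> the weight is the hook length; general \<open>t\<close> is needed because removing a
  corner of content \<open>k\<close> turns \<open>t\<close> into \<open>swap_at k t\<close>.
\<close>

fun cell_weight :: "(int \<Rightarrow> real) \<Rightarrow> cell set \<Rightarrow> cell \<Rightarrow> real" where
  "cell_weight t L (i, j) = t (int j - 1 - int (col_len L j)) - t (int (row_len L i) - int i)"

lemma row_len_insert:
  assumes L: "is_diagram L" and c: "(r, s) \<in> addable L"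
  shows "row_len (insert (r, s) L) i = row_len L i + (if i = r then 1 else 0)"
proof -
  have "finite {j. (i, j) \<in> L}"
    by (rule finite_subset[of _ "snd ` L"]) (use is_diagram_finite[OF L] in force)+
  moreover have "{j. (i, j) \<in> insert (r, s) L} = (if i = r then insert s {j. (i, j) \<in> L} else {j. (i, j) \<in> L})"
    by auto
  moreover have "(r, s) \<notin> L" using c by (simp add: addable_def)
  ultimately show ?thesis by (auto simp: row_len_def)
qed

lemma col_len_insert:
  assumes L: "is_diagram L" and c: "(r, s) \<in> addable L"
  shows "col_len (insert (r, s) L) j = col_len L j + (if j = s then 1 else 0)"
proof -
  have "finite {i. (i, j) \<in> L}"
    by (rule finite_subset[of _ "fst ` L"]) (use is_diagram_finite[OF L] in force)+
  moreover have "{i. (i, j) \<in> insert (r, s) L} = (if j = s then insert r {i. (i, j) \<in> L} else {i. (i, j) \<in> L})"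
    by auto
  moreover have "(r, s) \<notin> L" using c by (simp add: addable_def)
  ultimately show ?thesis by (auto simp: col_len_def)
qed

text \<open>In terms of the Maya diagram: for a cell of content \<open>k\<close>, the bead of row
  \<open>r\<close> is at \<open>k - 1\<close> and the hole of column \<open>s\<close> is at
  \<open>k\<close>.\<close>

lemma addable_len:
  assumes L: "is_diagram L" and c: "(r, s) \<in> addable L"
  shows "row_len L r = s - 1" "col_len L s = r - 1" "1 \<le> r" "1 \<le> s"
proof -
  have *: "(r, s) \<notin> L" "1 \<le> r" "1 \<le> s" "1 < r \<longrightarrow> (r - 1, s) \<in> L" "1 < s \<longrightarrow> (r, s - 1) \<in> L"
    using addable_iff[OF L] c by auto
  show "1 \<le> r" "1 \<le> s" using * by auto
  have "\<not> s \<le> row_len L r" "\<not> r \<le> col_len L s"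
    using mem_iff_row_len[OF L, of r s] mem_iff_col_len[OF L, of r s] * by auto
  moreover have "1 < s \<longrightarrow> s - 1 \<le> row_len L r" "1 < r \<longrightarrow> r - 1 \<le> col_len L s"
    using mem_iff_row_len[OF L, of r "s - 1"] mem_iff_col_len[OF L, of "r - 1" s] * by auto
  ultimately show "row_len L r = s - 1" "col_len L s = r - 1" by linarith+
qed

lemma cell_weight_insert_new:
  assumes L: "is_diagram L" and c: "c \<in> addable L"
  shows "cell_weight t (insert c L) c = t (content c - 1) - t (content c)"
proof -
  obtain r s where rs: "c = (r, s)" by (cases c)
  show ?thesis
    using addable_len[OF L c[unfolded rs]]
    by (simp add: rs row_len_insert[OF L c[unfolded rs]] col_len_insert[OF L c[unfolded rs]]
        of_nat_diff algebra_simps)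
qed

text \<open>Adding \<open>c\<close> exchanges the bead at \<open>k - 1\<close> with the hole at
  \<open>k\<close>. All other beads and holes stay where they are and avoid these two positions, so
  the effect is that of transposing the values of \<open>t\<close>.\<close>

lemma cell_weight_insert:
  assumes L: "is_diagram L" and c: "c \<in> addable L" and u: "u \<in> L"
  shows "cell_weight t (insert c L) u = cell_weight (swap_at (content c) t) L u"
proof -
  obtain r s where rs: "c = (r, s)" by (cases c)
  obtain i j where ij: "u = (i, j)" by (cases u)
  note len = addable_len[OF L c[unfolded rs]]
  have p: "1 \<le> i" "1 \<le> j" using is_diagram_pos[OF L] u ij by auto
  define k where "k = int s - int r"
  have s: "int s = k + int r" by (simp add: k_def)
  have row: "t (int (row_len (insert c L) i) - int i) = swap_at k t (int (row_len L i) - int i)"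
  proof (cases "i = r")
    case True
    then show ?thesis
      using len by (simp add: rs row_len_insert[OF L c[unfolded rs]] swap_at_def of_nat_diff k_def)
  next
    case False
    \<comment> \<open>Rows above \<open>r\<close> reach column \<open>s\<close>, so their beads lie
      to the right of \<open>k\<close>; rows below \<open>r\<close> are shorter than
      \<open>s\<close>, so their beads lie to the left of \<open>k - 1\<close>.\<close>
    have "int (row_len L i) - int i > k \<or> int (row_len L i) - int i < k - 1"
    proof (cases "i < r")
      case True
      then have "(r - 1, s) \<in> L" using addable_iff[OF L, of r s] c rs p by auto
      then have "(i, s) \<in> L" using is_diagram_down[OF L, of "r - 1" s i s] True p len by auto
      then have "s \<le> row_len L i" using mem_iff_row_len[OF L p(1) len(4)] by simp
      then show ?thesis using True s by linarith
    next
      case F: False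
      have "(r, s) \<notin> L" using c rs by (simp add: addable_def)
      then have "(i, s) \<notin> L" using is_diagram_down[OF L, of i s r s] F len by auto
      then have "row_len L i < s" using mem_iff_row_len[OF L p(1) len(4)] by simp
      then show ?thesis using F False s by linarith
    qed
    then show ?thesis using False by (auto simp: rs row_len_insert[OF L c[unfolded rs]] swap_at_def)
  qed
  have col: "t (int j - 1 - int (col_len (insert c L) j)) = swap_at k t (int j - 1 - int (col_len L j))"
  proof (cases "j = s")
    case True
    then show ?thesis
      using len by (simp add: rs col_len_insert[OF L c[unfolded rs]] swap_at_def of_nat_diff k_def algebra_simps)
  next
    case False
    have "int j - 1 - int (col_len L j) > k \<or> int j - 1 - int (col_len L j) < k - 1"
    proof (cases "j < s")
      case True
      then have "(r, s - 1) \<in> L" using addable_iff[OF L, of r s] c rs p by auto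
      then have "(r, j) \<in> L" using is_diagram_down[OF L, of r "s - 1" r j] True p len by auto
      then have "r \<le> col_len L j" using mem_iff_col_len[OF L len(3) p(2)] by simp
      then show ?thesis using True s by linarith
    next
      case F: False
      have "(r, s) \<notin> L" using c rs by (simp add: addable_def)
      then have "(r, j) \<notin> L" using is_diagram_down[OF L, of r j r s] F len by auto
      then have "col_len L j < r" using mem_iff_col_len[OF L len(3) p(2)] by simp
      then show ?thesis using F False s by linarith
    qed
    then show ?thesis using False by (auto simp: rs col_len_insert[OF L c[unfolded rs]] swap_at_def)
  qed
  show ?thesis
    using row col by (simp add: ij rs k_def)
qed

subsection \<open>Excited diagrams along a growth sequence\<close>

text \<open>The list runs backwards in time: its head is the cell added last.\<close>

fun growth :: "cell list \<Rightarrow> bool" where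
  "growth [] = True"
| "growth (c # cs) \<longleftrightarrow> growth cs \<and> c \<in> addable (set cs)"

text \<open>
  The subsets \<open>D\<close> of the sequence such that adding, for each cell of \<open>D\<close> in turn, a cell of the same
  content to the empty diagram produces \<open>M\<close>.
\<close>

fun excited_along :: "cell list \<Rightarrow> cell set \<Rightarrow> cell set set" where
  "excited_along [] M = (if M = {} then {{}} else {})"
| "excited_along (c # cs) M =
     excited_along cs M \<union> (\<Union>b\<in>removable_at (content c) M. insert c ` excited_along cs (M - {b}))"

definition excited_sum :: "(cell \<Rightarrow> real) \<Rightarrow> cell list \<Rightarrow> cell set \<Rightarrow> real" where
  "excited_sum w cs M = (\<Sum>D\<in>excited_along cs M. \<Prod>u\<in>D. w u)"

lemma growth_is_diagram: "growth cs \<Longrightarrow> is_diagram (set cs)"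
  by (cases cs) (auto simp: addable_def)

text \<open>A cell that maximises \<open>i + j\<close> is a corner; it can be taken as the cell
  added last.\<close>

lemma growth_exists:
  assumes "is_diagram L"
  shows "\<exists>cs. growth cs \<and> set cs = L"
  using assms
proof (induction "card L" arbitrary: L rule: less_induct)
  case less
  note fin = is_diagram_finite[OF less.prems]
  show ?case
  proof (cases "L = {}")
    case True
    then show ?thesis by (intro exI[of _ "[]"]) simp
  next
    case False
    have im: "finite ((\<lambda>(i, j). i + j) ` L)" "(\<lambda>(i, j). i + j) ` L \<noteq> {}" using fin False by auto
    obtain b where b: "b \<in> L" "(\<lambda>(i, j). i + j) b = Max ((\<lambda>(i, j). i + j) ` L)"
      using Max_in[OF im] by auto
    obtain i j where ij: "b = (i, j)" by (cases b)
    have "i' + j' \<le> i + j" if "(i', j') \<in> L" for i' j'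
      using Max_ge[OF im(1), of "i' + j'"] that b ij by force
    from this[of "i + 1" j] this[of i "j + 1"] have "b \<in> removable L"
      unfolding ij removable_iff[OF less.prems] using b ij by auto
    then have d: "is_diagram (L - {b})" by (simp add: removable_def)
    moreover have "card (L - {b}) < card L" using fin b by (meson card_Diff1_less)
    ultimately obtain cs where cs: "growth cs" "set cs = L - {b}" using less.hyps by blast
    have ins: "insert b (L - {b}) = L" using b by blast
    then have "growth (b # cs)" using cs less.prems by (simp add: addable_def)
    moreover have "set (b # cs) = L" using cs ins by simp
    ultimately show ?thesis by blast
  qed
qed

lemma finite_excited_along: "is_diagram M \<Longrightarrow> finite (excited_along cs M)"
  by (induction cs M rule: excited_along.induct) (auto simp: finite_removable_at removable_is_diagram)

text \<open>If \<open>b\<close> were strictly southeast of \<open>c\<close> on their common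
  diagonal, then \<open>c\<close> would lie in \<open>M - {b}\<close> and hence in \<open>L\<close>.
  So the passage from \<open>b\<close> to \<open>c\<close> goes down the diagonal, as excited moves
  do.\<close>

lemma diag_predecessor:
  assumes M: "is_diagram M" and L: "is_diagram L" and c: "c \<in> addable L"
    and b: "b \<in> removable_at (content c) M" and sub: "M - {b} \<subseteq> L"
  shows "fst b \<le> fst c"
proof (rule ccontr)
  assume n: "\<not> fst b \<le> fst c"
  obtain i j r s where bc: "b = (i, j)" "c = (r, s)" by (cases b, cases c)
  have bM: "(i, j) \<in> M" and k: "int j - int i = int s - int r"
    using b by (auto simp: bc removable_at_def removable_def)
  have p: "1 \<le> r" "1 \<le> s" using addable_len[OF L c[unfolded bc]] by auto
  have "(r, s) \<in> M" using is_diagram_down[OF M bM, of r s] n k p bc by auto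
  then have "c \<in> L" using sub n bc by auto
  then show False using c by (simp add: addable_def)
qed

text \<open>The first claim shows that the newest cell is never in an earlier \<open>D\<close>, the
  second that only \<open>D = set cs\<close> is possible for \<open>M = set cs\<close>, and the
  third that the sum vanishes for diagrams that do not fit into the shape.\<close>

lemma excited_along_subset:
  assumes "growth cs" "is_diagram M" "D \<in> excited_along cs M"
  shows "D \<subseteq> set cs \<and> card D = card M \<and> M \<subseteq> set cs"
  using assms
proof (induction cs arbitrary: M D)
  case Nil
  then show ?case by (auto split: if_splits)
next
  case (Cons c cs)
  have g: "growth cs" and c: "c \<in> addable (set cs)" using Cons.prems by auto
  note L = growth_is_diagram[OF g]
  show ?case
  proof (cases "D \<in> excited_along cs M")
    case True
    then show ?thesis using Cons.IH[OF g Cons.prems(2)] by auto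
  next
    case False
    then obtain b D' where b: "b \<in> removable_at (content c) M" and D': "D' \<in> excited_along cs (M - {b})"
      and D: "D = insert c D'" using Cons.prems(3) by auto
    have IH: "D' \<subseteq> set cs" "card D' = card (M - {b})" "M - {b} \<subseteq> set cs"
      using Cons.IH[OF g removable_is_diagram[OF b] D'] by auto
    have bM: "b \<in> M" using b by (auto simp: removable_at_def removable_def)
    have "c \<notin> D'" using IH c by (auto simp: addable_def)
    then have "card D = Suc (card (M - {b}))"
      using IH D finite_subset[OF IH(1)] by simp
    then have cD: "card D = card M"
      using card_Suc_Diff1[OF is_diagram_finite[OF Cons.prems(2)] bM] by simp
    have "b \<in> set (c # cs)"
    proof -
      obtain i j r s where bc: "b = (i, j)" "c = (r, s)" by (cases b, cases c)
      have k: "int j - int i = int s - int r" using b bc by (auto simp: removable_at_def)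
      have le: "i \<le> r" using diag_predecessor[OF Cons.prems(2) L c b IH(3)] bc by simp
      have d: "is_diagram (insert c (set cs))" using c by (simp add: addable_def)
      have "1 \<le> i \<and> 1 \<le> j" using is_diagram_pos[OF Cons.prems(2)] bM bc by blast
      then have "(i, j) \<in> insert c (set cs)"
        using is_diagram_down[OF d, of r s i j] le k bc by auto
      then show ?thesis using bc by simp
    qed
    then show ?thesis using D IH cD by auto
  qed
qed

text \<open>This is one operator \<open>1 + w c * F\<close> with \<open>F\<close> adding a cell of
  the content of \<open>c\<close>, read off at the coefficient of \<open>M\<close>. The two families
  of sets are disjoint because exactly those of the second contain \<open>c\<close>.\<close>

lemma excited_sum_Cons:
  assumes g: "growth (c # cs)" and M: "is_diagram M"
  shows "excited_sum w (c # cs) M = excited_sum w cs M +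
    w c * (\<Sum>b\<in>removable_at (content c) M. excited_sum w cs (M - {b}))"
proof -
  have gc: "growth cs" and c: "c \<notin> set cs" using g by (auto simp: addable_def)
  have notin: "c \<notin> D" if "is_diagram M'" "D \<in> excited_along cs M'" for D M'
    using excited_along_subset[OF gc that] c by auto
  have image: "(\<Sum>D\<in>insert c ` excited_along cs M'. \<Prod>u\<in>D. w u) = w c * excited_sum w cs M'"
    if M': "is_diagram M'" for M'
  proof -
    have "inj_on (insert c) (excited_along cs M')"
    proof (rule inj_onI)
      fix D D' assume D: "D \<in> excited_along cs M'" "D' \<in> excited_along cs M'" "insert c D = insert c D'"
      show "D = D'" using insert_ident[OF notin[OF M' D(1)] notin[OF M' D(2)]] D(3) by (rule iffD1)
    qed
    then have "(\<Sum>D\<in>insert c ` excited_along cs M'. \<Prod>u\<in>D. w u) =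
        (\<Sum>D\<in>excited_along cs M'. \<Prod>u\<in>insert c D. w u)"
      by (simp add: sum.reindex)
    also have "\<dots> = (\<Sum>D\<in>excited_along cs M'. w c * (\<Prod>u\<in>D. w u))"
    proof (rule sum.cong)
      fix D assume D: "D \<in> excited_along cs M'"
      have "finite D" using excited_along_subset[OF gc M' D] finite_subset by blast
      then show "(\<Prod>u\<in>insert c D. w u) = w c * (\<Prod>u\<in>D. w u)" using notin[OF M' D] by simp
    qed simp
    finally show ?thesis by (simp add: excited_sum_def sum_distrib_left)
  qed
  let ?R = "removable_at (content c) M"
  let ?U = "\<Union>b\<in>?R. insert c ` excited_along cs (M - {b})"
  \<comment> \<open>A diagonal carries at most one corner, so the union has at most one
    member.\<close>
  have U: "(\<Sum>D\<in>?U. \<Prod>u\<in>D. w u) = w c * (\<Sum>b\<in>?R. excited_sum w cs (M - {b}))"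
  proof (cases "?R = {}")
    case False
    then obtain b where b: "b \<in> ?R" by blast
    show ?thesis
      unfolding removable_at_singleton(1)[OF M b] using image[OF removable_is_diagram[OF b]] by simp
  qed simp
  have "finite ?U"
    by (auto simp: finite_removable_at[OF M] finite_excited_along removable_is_diagram)
  moreover have "excited_along cs M \<inter> ?U = {}" using notin[OF M] by auto
  ultimately show ?thesis
    unfolding excited_sum_def excited_along.simps
    using U by (simp add: sum.union_disjoint finite_excited_along[OF M] excited_sum_def)
qed

lemma excited_sum_cong:
  assumes "growth cs" "is_diagram M" "\<And>u. u \<in> set cs \<Longrightarrow> w u = w' u"
  shows "excited_sum w cs M = excited_sum w' cs M"
  unfolding excited_sum_def
proof (intro sum.cong prod.cong refl)
  fix D u assume "D \<in> excited_along cs M" "u \<in> D"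
  then show "w u = w' u" using excited_along_subset[OF assms(1,2)] assms(3) by blast
qed

text \<open>
  Let \<open>E\<close> remove a cell in all possible ways, \<open>F\<^sub>k\<close> add a cell of content \<open>k\<close>, and \<open>H\<^sub>t\<close> multiply \<open>M\<close>
  by \<open>- diag_sum t M\<close> plus a constant.
  Conjugating \<open>E - H\<^sub>t\<close> by \<open>exp (z F\<^sub>k)\<close> with \<open>z = t (k - 1) - t k\<close> gives \<open>E - H\<^sub>s\<close>
  for \<open>s = swap_at k t\<close>, so the product of these exponentials over the cells of \<open>L\<close>, applied to the
  empty diagram, is an eigenvector of \<open>E - H\<^sub>t\<close>.
\<close>

lemma excited_sum_recursion:
  assumes "growth cs" "is_diagram M"
  shows "(\<Sum>a\<in>addable M. excited_sum (cell_weight t (set cs)) cs (insert a M)) =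
    (diag_sum t (set cs) - diag_sum t M) * excited_sum (cell_weight t (set cs)) cs M"
  using assms
proof (induction cs arbitrary: M t)
  case Nil
  then show ?case by (auto simp: excited_sum_def diag_sum_def)
next
  case (Cons c cs)
  define k where "k = content c"
  define z where "z = t (k - 1) - t k"
  define f where "f = excited_sum (cell_weight (swap_at k t) (set cs)) cs"
  have g: "growth cs" and c: "c \<in> addable (set cs)" using Cons.prems by auto
  note L = growth_is_diagram[OF g] and M = Cons.prems(2)
  \<comment> \<open>The old cells see the weights for \<open>swap_at k t\<close>, and the new cell
    has weight \<open>z\<close>.\<close>
  have step: "excited_sum (cell_weight t (set (c # cs))) (c # cs) M' =
      f M' + z * (\<Sum>b\<in>removable_at k M'. f (M' - {b}))" if M': "is_diagram M'" for M'
  proof -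
    have eq: "excited_sum (cell_weight t (set (c # cs))) cs M'' = f M''" if "is_diagram M''" for M''
      unfolding f_def k_def using cell_weight_insert[OF L c]
      by (intro excited_sum_cong[OF g that]) auto
    have "cell_weight t (set (c # cs)) c = z"
      using cell_weight_insert_new[OF L c] by (simp add: z_def k_def)
    then show ?thesis
      unfolding excited_sum_Cons[OF Cons.prems(1) M'] k_def[symmetric]
      by (simp only: eq[OF M'] eq[OF removable_is_diagram] cong: sum.cong)
  qed
  have IH: "(\<Sum>a\<in>addable M'. f (insert a M')) =
      (diag_sum (swap_at k t) (set cs) - diag_sum (swap_at k t) M') * f M'" if "is_diagram M'" for M'
    unfolding f_def by (rule Cons.IH[OF g that])
  \<comment> \<open>The correction from the main diagonal enters the diagonal sums of
    \<open>set cs\<close>, \<open>M\<close> and \<open>M - {b}\<close> equally, so it drops out of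
    their differences.\<close>
  define \<delta> where "\<delta> = (if k = 0 then z else 0)"
  have cnot: "c \<notin> set cs" and Lc: "is_diagram (set (c # cs))" using c by (auto simp: addable_def)
  have rem: "set (c # cs) - {c} = set cs" using cnot by auto
  have "c \<in> removable_at k (set (c # cs))"
    using L rem by (simp add: removable_at_def removable_def k_def)
  from diag_sum_swap_remove[OF Lc this, of t]
  have dL: "diag_sum (swap_at k t) (set cs) = diag_sum t (set (c # cs)) - \<delta>"
    unfolding rem by (simp add: \<delta>_def z_def)
  define \<kappa> where "\<kappa> = real (card (addable_at k M)) - real (card (removable_at k M))"
  have dM: "diag_sum (swap_at k t) M = diag_sum t M + z * \<kappa> - \<delta>"
    using diag_sum_swap[OF M, of k t] by (cases "k = 0") (simp_all add: \<kappa>_def z_def \<delta>_def algebra_simps)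
  have dMb: "diag_sum (swap_at k t) (M - {b}) = diag_sum t M - \<delta>" if "b \<in> removable_at k M" for b
    using diag_sum_swap_remove[OF M that, of t] by (simp add: z_def \<delta>_def)
  define A where "A = diag_sum t (set (c # cs)) - diag_sum t M"
  have "(\<Sum>a\<in>addable M. excited_sum (cell_weight t (set (c # cs))) (c # cs) (insert a M)) =
      (\<Sum>a\<in>addable M. f (insert a M)) +
      z * (\<Sum>a\<in>addable M. \<Sum>b\<in>removable_at k (insert a M). f (insert a M - {b}))"
    by (simp only: step[OF addable_is_diagram] sum.distrib sum_distrib_left cong: sum.cong)
  \<comment> \<open>By the induction hypothesis the eigenvalue at \<open>M\<close> is off by
    \<open>z * \<kappa>\<close>, which the commutator will compensate; at \<open>M - {b}\<close> it
    is already \<open>A\<close>.\<close>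
  also have "(\<Sum>a\<in>addable M. f (insert a M)) = (A - z * \<kappa>) * f M"
    unfolding IH[OF M] dL dM A_def by (simp add: algebra_simps)
  also have "(\<Sum>a\<in>addable M. \<Sum>b\<in>removable_at k (insert a M). f (insert a M - {b})) =
      (\<Sum>b\<in>removable_at k M. \<Sum>a\<in>addable (M - {b}). f (insert a (M - {b}))) + \<kappa> * f M"
    unfolding \<kappa>_def by (rule add_remove_commutator[OF M])
  also have "(\<Sum>b\<in>removable_at k M. \<Sum>a\<in>addable (M - {b}). f (insert a (M - {b}))) =
      A * (\<Sum>b\<in>removable_at k M. f (M - {b}))"
    unfolding sum_distrib_left
  proof (rule sum.cong[OF refl])
    fix b assume b: "b \<in> removable_at k M"
    show "(\<Sum>a\<in>addable (M - {b}). f (insert a (M - {b}))) = A * f (M - {b})"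
      unfolding IH[OF removable_is_diagram[OF b]] dL dMb[OF b] A_def by simp
  qed
  also have "(A - z * \<kappa>) * f M + z * (A * (\<Sum>b\<in>removable_at k M. f (M - {b})) + \<kappa> * f M) =
      A * (f M + z * (\<Sum>b\<in>removable_at k M. f (M - {b})))"
    by (simp add: algebra_simps)
  finally show ?case unfolding step[OF M] A_def .
qed

subsection \<open>Linear extensions\<close>

definition linear_extensions :: "('a \<Rightarrow> 'a \<Rightarrow> bool) \<Rightarrow> 'a set \<Rightarrow> ('a \<Rightarrow> nat) set" where
  "linear_extensions R S =
     {T \<in> S \<rightarrow>\<^sub>E {1..card S}. bij_betw T S {1..card S} \<and> (\<forall>u\<in>S. \<forall>v\<in>S. R u v \<longrightarrow> T u < T v)}"

lemma linear_extensions_iff: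
  assumes "finite S"
  shows "T \<in> linear_extensions R S \<longleftrightarrow>
    T \<in> S \<rightarrow>\<^sub>E {1..card S} \<and> inj_on T S \<and> (\<forall>u\<in>S. \<forall>v\<in>S. R u v \<longrightarrow> T u < T v)"
proof -
  have "bij_betw T S {1..card S}" if "T \<in> S \<rightarrow>\<^sub>E {1..card S}" "inj_on T S"
  proof -
    have "T ` S \<subseteq> {1..card S}" using that(1) by auto
    moreover have "card (T ` S) = card {1..card S}" using card_image[OF that(2)] by simp
    ultimately show ?thesis
      using that(2) card_subset_eq[of "{1..card S}" "T ` S"] by (simp add: bij_betw_def)
  qed
  then show ?thesis unfolding linear_extensions_def by (auto simp: bij_betw_def)
qed

lemma card_linear_extensions_empty: "card (linear_extensions R {}) = 1"
proof -
  have "linear_extensions R {} = {\<lambda>_. undefined}"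
    by (auto simp: linear_extensions_iff)
  then show ?thesis by simp
qed

lemma finite_linear_extensions: "finite S \<Longrightarrow> finite (linear_extensions R S)"
  by (rule finite_subset[of _ "S \<rightarrow>\<^sub>E {1..card S}"]) (auto simp: linear_extensions_def finite_PiE)

text \<open>The element with value 1 has no predecessor under \<open>R\<close>; deleting it and
  lowering all other values by 1 is a bijection.\<close>

lemma card_linear_extensions_rec:
  assumes S: "finite S" "S \<noteq> {}"
  shows "card (linear_extensions R S) =
    (\<Sum>a\<in>{a \<in> S. \<forall>u\<in>S. \<not> R u a}. card (linear_extensions R (S - {a})))"
proof -
  let ?A = "{a \<in> S. \<forall>u\<in>S. \<not> R u a}"
  \<comment> \<open>\<open>up\<close> and \<open>down\<close> are the two mutually inverse maps. The
    truncated subtraction in \<open>down\<close> is harmless, as every element other than the first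
    has value at least 2.\<close>
  define up where "up = (\<lambda>(a, T). \<lambda>u\<in>S. if u = a then 1 else T u + 1 :: nat)"
  define down where "down T = (inv_into S T 1, \<lambda>u\<in>S - {inv_into S T 1}. T u - 1)" for T :: "'a \<Rightarrow> nat"
  have pos: "1 \<le> card S" using S by (simp add: Suc_leI card_gt_0_iff)
  have up_mem: "up (a, T) \<in> linear_extensions R S \<and> down (up (a, T)) = (a, T)"
    if a: "a \<in> ?A" and T: "T \<in> linear_extensions R (S - {a})" for a T
  proof -
    have card: "card (S - {a}) = card S - 1" using a S by simp
    have T1: "T \<in> S - {a} \<rightarrow>\<^sub>E {1..card S - 1}" "inj_on T (S - {a})"
      "\<And>u v. u \<in> S - {a} \<Longrightarrow> v \<in> S - {a} \<Longrightarrow> R u v \<Longrightarrow> T u < T v"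
      using T S by (auto simp: linear_extensions_iff card)
    have rng: "1 \<le> T u \<and> T u + 1 \<le> card S" if "u \<in> S" "u \<noteq> a" for u
      using PiE_mem[OF T1(1), of u] that pos by auto
    have val: "up (a, T) a = 1" "\<And>u. u \<in> S \<Longrightarrow> u \<noteq> a \<Longrightarrow> up (a, T) u = T u + 1"
      using a by (auto simp: up_def)
    have inj: "inj_on (up (a, T)) S"
    proof (rule inj_onI)
      fix u v assume uv: "u \<in> S" "v \<in> S" "up (a, T) u = up (a, T) v"
      show "u = v"
      proof (cases "u = a \<or> v = a")
        case True
        then show ?thesis using uv val rng[of u] rng[of v] by (cases "u = a"; cases "v = a") auto
      next
        case False
        then have "T u = T v" using uv val by simp
        then show ?thesis using inj_onD[OF T1(2)] uv False by blast
      qed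
    qed
    have "up (a, T) u < up (a, T) v" if "u \<in> S" "v \<in> S" "R u v" for u v
    proof -
      have "v \<noteq> a" using a that by blast
      then show ?thesis
        using that val T1(3)[of u v] rng[of v] by (cases "u = a") auto
    qed
    moreover have "up (a, T) \<in> S \<rightarrow>\<^sub>E {1..card S}"
    proof (rule PiE_I)
      fix u assume "u \<in> S"
      then show "up (a, T) u \<in> {1..card S}"
        using val rng[of u] pos by (cases "u = a") auto
    qed (simp add: up_def)
    ultimately have mem: "up (a, T) \<in> linear_extensions R S"
      using inj S by (simp add: linear_extensions_iff)
    have inv: "inv_into S (up (a, T)) 1 = a"
      using inv_into_f_f[OF inj, of a] a val by simp
    have "(\<lambda>u\<in>S - {a}. up (a, T) u - 1) = T"
      by (rule extensionalityI[of _ "S - {a}"]) (use T1(1) val in \<open>auto simp: PiE_iff\<close>)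
    then have "down (up (a, T)) = (a, T)" by (simp only: down_def inv)
    then show ?thesis using mem by blast
  qed
  have down_mem: "down T \<in> (SIGMA a:?A. linear_extensions R (S - {a})) \<and> up (down T) = T"
    if "T \<in> linear_extensions R S" for T
  proof -
    have T: "T \<in> S \<rightarrow>\<^sub>E {1..card S}" "bij_betw T S {1..card S}"
      "\<And>u v. u \<in> S \<Longrightarrow> v \<in> S \<Longrightarrow> R u v \<Longrightarrow> T u < T v"
      using that by (auto simp: linear_extensions_def)
    have inj: "inj_on T S" using T(2) by (simp add: bij_betw_def)
    define a where "a = inv_into S T 1"
    have "1 \<in> T ` S" using T(2) pos by (simp add: bij_betw_def)
    then have a: "a \<in> S" "T a = 1"
      unfolding a_def by (auto simp: inv_into_into f_inv_into_f)
    have rng: "1 \<le> T u \<and> T u \<le> card S" if "u \<in> S" for u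
      using PiE_mem[OF T(1) that] by auto
    have ge2: "2 \<le> T u" if "u \<in> S - {a}" for u
    proof -
      have "T u \<noteq> 1" using inj_onD[OF inj, of u a] a that by auto
      then show ?thesis using rng[of u] that by auto
    qed
    have aA: "a \<in> ?A"
      using a T(3)[of _ a] rng by fastforce
    have card: "card (S - {a}) = card S - 1" using a S by simp
    let ?T = "\<lambda>u\<in>S - {a}. T u - 1"
    have "?T \<in> S - {a} \<rightarrow>\<^sub>E {1..card S - 1}"
    proof (rule PiE_I)
      fix u assume u: "u \<in> S - {a}"
      show "?T u \<in> {1..card S - 1}" using u ge2[OF u] rng[of u] by auto
    qed auto
    moreover have "inj_on ?T (S - {a})"
    proof (rule inj_onI)
      fix u v assume uv: "u \<in> S - {a}" "v \<in> S - {a}" "?T u = ?T v"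
      then have "T u = T v" using ge2[OF uv(1)] ge2[OF uv(2)] by simp
      then show "u = v" using inj_onD[OF inj] uv by blast
    qed
    moreover have "?T u < ?T v" if "u \<in> S - {a}" "v \<in> S - {a}" "R u v" for u v
      using T(3)[of u v] ge2[OF that(1)] that by auto
    ultimately have "?T \<in> linear_extensions R (S - {a})"
      using S by (auto simp: linear_extensions_iff card)
    moreover have "up (a, ?T) = T"
      by (rule extensionalityI[of _ S]) (use T(1) a ge2 in \<open>force simp: up_def PiE_iff\<close>)+
    ultimately show ?thesis using aA unfolding down_def a_def[symmetric] by auto
  qed
  have "bij_betw up (SIGMA a:?A. linear_extensions R (S - {a})) (linear_extensions R S)"
  proof (rule bij_betw_byWitness[of _ down])
    show "down ` linear_extensions R S \<subseteq> (SIGMA a:?A. linear_extensions R (S - {a}))"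
      using down_mem by blast
  qed (use up_mem down_mem in auto)
  then have "card (linear_extensions R S) = card (SIGMA a:?A. linear_extensions R (S - {a}))"
    by (rule bij_betw_same_card[symmetric])
  also have "\<dots> = (\<Sum>a\<in>?A. card (linear_extensions R (S - {a})))"
    by (rule card_SigmaI) (use S finite_linear_extensions in auto)
  finally show ?thesis .
qed

subsection \<open>Excited moves\<close>

text \<open>The ambient set is arbitrary, so that it can follow a growth sequence cell by
  cell.\<close>

definition cell_move :: "cell set \<Rightarrow> cell set \<Rightarrow> cell set \<Rightarrow> bool" where
  "cell_move L D D' \<longleftrightarrow> (\<exists>i j. (i, j) \<in> D \<and> {(i + 1, j), (i, j + 1), (i + 1, j + 1)} \<subseteq> L - D \<and>
     D' = insert (i + 1, j + 1) (D - {(i, j)}))"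

lemma excited_move_eq: "excited_move la = cell_move (young_diagram la)"
  by (intro ext) (simp add: excited_move_def active_def cell_move_def)

lemma moves_mono:
  assumes "(cell_move L)\<^sup>*\<^sup>* D D'" "L \<subseteq> L'"
  shows "(cell_move L')\<^sup>*\<^sup>* D D'"
proof (rule rtranclp_mono[THEN predicate2D, OF _ assms(1)])
  show "cell_move L \<le> cell_move L'"
    using assms(2) unfolding cell_move_def by blast
qed

lemma moves_subset:
  assumes "(cell_move L)\<^sup>*\<^sup>* D D'" "D \<subseteq> L"
  shows "D' \<subseteq> L"
  using assms by induction (auto simp: cell_move_def)

text \<open>A move inside \<open>L\<close> inspects only cells of \<open>L\<close>, so an occupied
  cell outside \<open>L\<close> cannot block it.\<close>

lemma moves_insert:
  assumes "(cell_move L)\<^sup>*\<^sup>* D D'" "D \<subseteq> L" "c \<notin> L"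
  shows "(cell_move (insert c L))\<^sup>*\<^sup>* (insert c D) (insert c D')"
  using assms(1)
proof induction
  case (step D' D'')
  then have "c \<notin> D'" using moves_subset assms by blast
  obtain i j where m: "(i, j) \<in> D'" "{(i + 1, j), (i, j + 1), (i + 1, j + 1)} \<subseteq> L - D'"
    "D'' = insert (i + 1, j + 1) (D' - {(i, j)})"
    using step.hyps(2) unfolding cell_move_def by blast
  have "c \<noteq> (i, j)" using \<open>c \<notin> D'\<close> m(1) by blast
  then have "insert c D'' = insert (i + 1, j + 1) (insert c D' - {(i, j)})"
    unfolding m(3) by blast
  moreover have "{(i + 1, j), (i, j + 1), (i + 1, j + 1)} \<subseteq> insert c L - insert c D'"
    using m(2) assms(3) by blast
  ultimately have "cell_move (insert c L) (insert c D') (insert c D'')"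
    unfolding cell_move_def using m(1) by blast
  then show ?case using step.IH by simp
qed simp

text \<open>No other cell of \<open>M\<close> lies weakly southeast of a corner, so the corner can
  slide down its diagonal unobstructed.\<close>

lemma slide_corner:
  assumes M: "is_diagram M" and L: "is_diagram L" and b: "(i, j) \<in> removable M"
    and mem: "(i + n, j + n) \<in> L"
  shows "(cell_move L)\<^sup>*\<^sup>* M (insert (i + n, j + n) (M - {(i, j)}))"
  using mem
proof (induction n)
  case 0
  have "insert (i, j) (M - {(i, j)}) = M" using b by (auto simp: removable_def)
  then show ?case by simp
next
  case (Suc n)
  have r: "(i, j) \<in> M" "(i + 1, j) \<notin> M" "(i, j + 1) \<notin> M" using b removable_iff[OF M] by auto
  have p: "1 \<le> i" "1 \<le> j" using is_diagram_pos[OF M r(1)] by auto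
  have out: "(i', j') \<notin> M" if "i \<le> i'" "j \<le> j'" "(i', j') \<noteq> (i, j)" for i' j'
  proof
    assume "(i', j') \<in> M"
    moreover have "i + 1 \<le> i' \<or> j + 1 \<le> j'" using that by auto
    ultimately show False
      using is_diagram_down[OF M, of i' j' "i + 1" j] is_diagram_down[OF M, of i' j' i "j + 1"] r p that by auto
  qed
  have L': "(i', j') \<in> L" if "i \<le> i'" "j \<le> j'" "i' \<le> i + Suc n" "j' \<le> j + Suc n" for i' j'
    using is_diagram_down[OF L Suc.prems, of i' j'] that p by auto
  let ?D = "insert (i + n, j + n) (M - {(i, j)})"
  have "?D - {(i + n, j + n)} = M - {(i, j)}"
    using out[of "i + n" "j + n"] by (cases n) auto
  then have "insert (i + Suc n, j + Suc n) (M - {(i, j)}) =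
      insert (i + n + 1, j + n + 1) (?D - {(i + n, j + n)})" by simp
  moreover have "{(i + n + 1, j + n), (i + n, j + n + 1), (i + n + 1, j + n + 1)} \<subseteq> L - ?D"
    using L' out by auto
  ultimately have "cell_move L ?D (insert (i + Suc n, j + Suc n) (M - {(i, j)}))"
    unfolding cell_move_def by blast
  moreover have "(cell_move L)\<^sup>*\<^sup>* M ?D" using Suc.IH L'[of "i + n" "j + n"] by simp
  ultimately show ?case by simp
qed

text \<open>If \<open>c\<close> was used for the corner \<open>b\<close>, first slide
  \<open>b\<close> to \<open>c\<close> in the larger shape, then replay the moves from
  \<open>M - {b}\<close> in the smaller shape with \<open>c\<close> carried along.\<close>

lemma excited_along_moves:
  assumes "growth cs" "is_diagram M" "D \<in> excited_along cs M"
  shows "(cell_move (set cs))\<^sup>*\<^sup>* M D"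
  using assms
proof (induction cs arbitrary: M D)
  case Nil
  then show ?case by (auto split: if_splits)
next
  case (Cons c cs)
  have g: "growth cs" and c: "c \<in> addable (set cs)" using Cons.prems by auto
  note L = growth_is_diagram[OF g] and M = Cons.prems(2)
  show ?case
  proof (cases "D \<in> excited_along cs M")
    case True
    then show ?thesis using moves_mono[OF Cons.IH[OF g M True], of "set (c # cs)"] by auto
  next
    case False
    then obtain b D' where b: "b \<in> removable_at (content c) M" and D': "D' \<in> excited_along cs (M - {b})"
      and D: "D = insert c D'" using Cons.prems(3) by auto
    note Mb = removable_is_diagram[OF b]
    have sub: "M - {b} \<subseteq> set cs" using excited_along_subset[OF g Mb D'] by blast
    have cn: "c \<notin> set cs" using c by (simp add: addable_def)
    obtain i j r s where bc: "b = (i, j)" "c = (r, s)" by (cases b, cases c)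
    have k: "int j - int i = int s - int r" "(i, j) \<in> removable M"
      using b bc by (auto simp: removable_at_def)
    have "i \<le> r" using diag_predecessor[OF M L c b sub] bc by simp
    then have rs: "c = (i + (r - i), j + (r - i))" using k bc by auto
    have "is_diagram (set (c # cs))" using c by (simp add: addable_def)
    then have "(cell_move (set (c # cs)))\<^sup>*\<^sup>* M (insert c (M - {b}))"
      unfolding bc(1) rs by (rule slide_corner[OF M _ k(2)]) (simp add: rs)
    also have "(cell_move (set (c # cs)))\<^sup>*\<^sup>* (insert c (M - {b})) D"
      unfolding D using moves_insert[OF Cons.IH[OF g Mb D'] sub cn] by simp
    finally show ?thesis .
  qed
qed

text \<open>Use exactly the cells of \<open>M\<close>. When the newest cell \<open>c\<close> is in
  \<open>M\<close> it is a corner, because \<open>M - {c}\<close> is the intersection of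
  \<open>M\<close> with the earlier shape.\<close>

lemma self_excited_along:
  assumes "growth cs" "is_diagram M" "M \<subseteq> set cs"
  shows "M \<in> excited_along cs M"
  using assms
proof (induction cs arbitrary: M)
  case (Cons c cs)
  have g: "growth cs" and c: "c \<in> addable (set cs)" using Cons.prems by auto
  note L = growth_is_diagram[OF g] and M = Cons.prems(2)
  show ?case
  proof (cases "c \<in> M")
    case True
    have eq: "M \<inter> set cs = M - {c}" using Cons.prems(3) c by (auto simp: addable_def)
    have d: "is_diagram (M - {c})" using is_diagram_Int[OF M L] by (simp add: eq)
    then have "c \<in> removable_at (content c) M" using True by (simp add: removable_at_def removable_def)
    moreover have "M - {c} \<in> excited_along cs (M - {c})"
      using Cons.IH[OF g d] Cons.prems(3) by auto
    moreover have "insert c (M - {c}) = M" using True by blast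
    ultimately show ?thesis by (metis (no_types, lifting) UN_I UnI2 excited_along.simps(2) imageI)
  next
    case False
    then have "M \<subseteq> set cs" using Cons.prems(3) by auto
    then show ?thesis using Cons.IH[OF g M] by simp
  qed
qed simp

subsection \<open>Naruse's formula and the bounds\<close>

definition precedes :: "cell \<Rightarrow> cell \<Rightarrow> bool" where
  "precedes u v \<longleftrightarrow> (fst u = fst v \<and> snd u < snd v) \<or> (snd u = snd v \<and> fst u < fst v)"

lemma standard_tableaux_eq:
  "standard_tableaux la mu = linear_extensions precedes (skew_diagram la mu)"
  unfolding standard_tableaux_def linear_extensions_def
  by (intro Collect_cong) (auto simp: precedes_def)

text \<open>This matches the two recursions: the possible places of the entry 1 are the cells by
  which \<open>M\<close> can grow inside \<open>L\<close>.\<close>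

lemma minimal_cells_eq:
  assumes L: "is_diagram L" and M: "is_diagram M" and "M \<subseteq> L"
  shows "{a \<in> L - M. \<forall>u\<in>L - M. \<not> precedes u a} = {a \<in> addable M. a \<in> L}"
proof -
  have "(\<forall>u\<in>L - M. \<not> precedes u (i, j)) \<longleftrightarrow>
      1 \<le> i \<and> 1 \<le> j \<and> (1 < i \<longrightarrow> (i - 1, j) \<in> M) \<and> (1 < j \<longrightarrow> (i, j - 1) \<in> M)"
    if a: "(i, j) \<in> L" "(i, j) \<notin> M" for i j
  proof
    assume min: "\<forall>u\<in>L - M. \<not> precedes u (i, j)"
    have p: "1 \<le> i" "1 \<le> j" using is_diagram_pos[OF L a(1)] by auto
    have "(i - 1, j) \<in> M" if "1 < i"
    proof -
      have "(i - 1, j) \<in> L" using is_diagram_down[OF L a(1), of "i - 1" j] p that by auto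
      moreover have "precedes (i - 1, j) (i, j)" using that by (simp add: precedes_def)
      ultimately show ?thesis using min by blast
    qed
    moreover have "(i, j - 1) \<in> M" if "1 < j"
    proof -
      have "(i, j - 1) \<in> L" using is_diagram_down[OF L a(1), of i "j - 1"] p that by auto
      moreover have "precedes (i, j - 1) (i, j)" using that by (simp add: precedes_def)
      ultimately show ?thesis using min by blast
    qed
    ultimately show "1 \<le> i \<and> 1 \<le> j \<and> (1 < i \<longrightarrow> (i - 1, j) \<in> M) \<and> (1 < j \<longrightarrow> (i, j - 1) \<in> M)"
      using p by blast
  next
    assume R: "1 \<le> i \<and> 1 \<le> j \<and> (1 < i \<longrightarrow> (i - 1, j) \<in> M) \<and> (1 < j \<longrightarrow> (i, j - 1) \<in> M)"
    show "\<forall>u\<in>L - M. \<not> precedes u (i, j)"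
    proof (intro ballI notI)
      fix u assume u: "u \<in> L - M" "precedes u (i, j)"
      obtain i' j' where ij: "u = (i', j')" by (cases u)
      have p: "1 \<le> i'" "1 \<le> j'" using is_diagram_pos[OF L] u ij by auto
      consider "i' = i" "j' < j" | "j' = j" "i' < i" using u(2) ij by (auto simp: precedes_def)
      then have "u \<in> M"
      proof cases
        case 1
        then have "(i, j - 1) \<in> M" using R p by auto
        then show ?thesis using is_diagram_down[OF M, of i "j - 1" i' j'] 1 p ij by auto
      next
        case 2
        then have "(i - 1, j) \<in> M" using R p by auto
        then show ?thesis using is_diagram_down[OF M, of "i - 1" j i' j'] 2 p ij by auto
      qed
      then show False using u by blast
    qed
  qed
  then have "a \<in> {a \<in> L - M. \<forall>u\<in>L - M. \<not> precedes u a} \<longleftrightarrow> a \<in> {a \<in> addable M. a \<in> L}" for a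
    using addable_iff[OF M, of "fst a" "snd a"] by (cases a) auto
  then show ?thesis by blast
qed

lemma excited_sum_self:
  assumes g: "growth cs"
  shows "excited_sum w cs (set cs) = (\<Prod>u\<in>set cs. w u)"
proof -
  note L = growth_is_diagram[OF g]
  have "D = set cs" if "D \<in> excited_along cs (set cs)" for D
    using excited_along_subset[OF g L that] by (simp add: card_subset_eq)
  then have "excited_along cs (set cs) = {set cs}"
    using self_excited_along[OF g L] by blast
  then show ?thesis by (simp add: excited_sum_def)
qed

abbreviation hook_weight :: "cell set \<Rightarrow> cell \<Rightarrow> real" where
  "hook_weight \<equiv> cell_weight (\<lambda>x. - real_of_int x)"

text \<open>Multiplying by all hooks of the shape turns the reciprocals over the complement of
  \<open>D\<close> into a product over \<open>D\<close> and avoids division. Both sides satisfy the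
  same recursion in \<open>M\<close>, and they agree at \<open>M = set cs\<close>.\<close>

lemma naruse_hook_length_formula:
  assumes "growth cs" "is_diagram M" "M \<subseteq> set cs"
  shows "real (card (linear_extensions precedes (set cs - M))) * (\<Prod>u\<in>set cs. hook_weight (set cs) u) =
    fact (card (set cs - M)) * excited_sum (hook_weight (set cs)) cs M"
  using assms(2,3)
proof (induction "card (set cs - M)" arbitrary: M)
  case 0
  then have "set cs - M = {}" by simp
  moreover from this have "M = set cs" using 0 by blast
  ultimately show ?case
    by (simp add: card_linear_extensions_empty excited_sum_self[OF assms(1)])
next
  case (Suc n)
  let ?L = "set cs" and ?N = "excited_sum (hook_weight (set cs)) cs"
  let ?e = "\<lambda>S. real (card (linear_extensions precedes S))"
  let ?A = "{a \<in> addable M. a \<in> ?L}"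
  let ?P = "\<Prod>u\<in>?L. hook_weight ?L u"
  note L = growth_is_diagram[OF assms(1)] and M = Suc.prems(1)
  have step: "?e (?L - M - {a}) * ?P = fact n * ?N (insert a M)" if a: "a \<in> ?A" for a
  proof -
    have am: "a \<notin> M" "is_diagram (insert a M)" using a by (auto simp: addable_def)
    have eq: "?L - insert a M = ?L - M - {a}" by blast
    have "card (?L - insert a M) = n" unfolding eq using Suc.hyps(2) a am by simp
    then show ?thesis using Suc.hyps(1)[of "insert a M"] am(2) a Suc.prems(2) by (simp add: eq)
  qed
  have "?L - M \<noteq> {}" using Suc.hyps(2) by (metis card.empty nat.distinct(1))
  then have "?e (?L - M) = (\<Sum>a\<in>?A. ?e (?L - M - {a}))"
    using card_linear_extensions_rec[of "?L - M" precedes] minimal_cells_eq[OF L M Suc.prems(2)] by simp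
  then have "?e (?L - M) * ?P = (\<Sum>a\<in>?A. ?e (?L - M - {a}) * ?P)"
    by (simp add: sum_distrib_right)
  also have "\<dots> = fact n * (\<Sum>a\<in>?A. ?N (insert a M))"
    unfolding sum_distrib_left by (rule sum.cong[OF refl step])
  \<comment> \<open>Cells addable outside the shape contribute 0, so the sum may run over all
    addable cells, as the eigenvalue equation demands.\<close>
  also have "(\<Sum>a\<in>?A. ?N (insert a M)) = (\<Sum>a\<in>addable M. ?N (insert a M))"
  proof (rule sum.mono_neutral_left)
    show "\<forall>a\<in>addable M - ?A. ?N (insert a M) = 0"
    proof
      fix a assume a: "a \<in> addable M - ?A"
      then have "excited_along cs (insert a M) = {}"
        using excited_along_subset[OF assms(1), of "insert a M"] by (auto simp: addable_def)
      then show "?N (insert a M) = 0" by (simp add: excited_sum_def)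
    qed
  qed (use finite_addable[OF M] in auto)
  \<comment> \<open>For \<open>t x = - x\<close> the eigenvalue is the number of cells of the skew
    shape, the factor that raises \<open>fact n\<close> to \<open>fact (Suc n)\<close>.\<close>
  also have "\<dots> = (real (card ?L) - real (card M)) * ?N M"
    unfolding excited_sum_recursion[OF assms(1) M] by (simp add: diag_sum_def)
  also have "real (card ?L) - real (card M) = real (Suc n)"
    using Suc.hyps(2) card_Diff_subset[OF is_diagram_finite[OF M] Suc.prems(2)]
      card_mono[OF _ Suc.prems(2)] by (simp add: of_nat_diff)
  finally show ?case unfolding Suc.hyps(2)[symmetric] by (simp add: algebra_simps)
qed

section \<open>Hook products decrease along excited moves\<close>

lemma hook_weight_ge_one:
  assumes L: "is_diagram L" and u: "u \<in> L"
  shows "1 \<le> hook_weight L u"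
proof -
  obtain i j where ij: "u = (i, j)" by (cases u)
  have "1 \<le> i" "1 \<le> j" using is_diagram_pos[OF L] u ij by auto
  then have "j \<le> row_len L i" "i \<le> col_len L j"
    using mem_iff_row_len[OF L, of i j] mem_iff_col_len[OF L, of i j] u ij by auto
  then show ?thesis by (simp add: ij)
qed

text \<open>Row and column lengths decrease weakly along the diagram, while \<open>i\<close> and
  \<open>j\<close> both grow.\<close>

lemma hook_weight_diagonal_mono:
  assumes L: "is_diagram L" and u: "(i, j) \<in> L" "(i + 1, j + 1) \<in> L"
  shows "hook_weight L (i + 1, j + 1) \<le> hook_weight L (i, j)"
proof -
  have p: "1 \<le> i" "1 \<le> j" using is_diagram_pos[OF L u(1)] by auto
  have "(i + 1, row_len L (i + 1)) \<in> L" "(col_len L (j + 1), j + 1) \<in> L"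
    using mem_iff_row_len[OF L, of "i + 1" "j + 1"] mem_iff_col_len[OF L, of "i + 1" "j + 1"] u
      mem_iff_row_len[OF L, of "i + 1" "row_len L (i + 1)"]
      mem_iff_col_len[OF L, of "col_len L (j + 1)" "j + 1"] by auto
  then have "(i, row_len L (i + 1)) \<in> L" "(col_len L (j + 1), j) \<in> L"
    using is_diagram_down[OF L, of "i + 1" "row_len L (i + 1)" i "row_len L (i + 1)"]
      is_diagram_down[OF L, of "col_len L (j + 1)" "j + 1" "col_len L (j + 1)" j]
      is_diagram_pos[OF L] p by auto
  then have "row_len L (i + 1) \<le> row_len L i" "col_len L (j + 1) \<le> col_len L j"
    using mem_iff_row_len[OF L p(1), of "row_len L (i + 1)"]
      mem_iff_col_len[OF L _ p(2), of "col_len L (j + 1)"] is_diagram_pos[OF L] by auto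
  then show ?thesis by simp
qed

lemma moves_prod_hook_le:
  assumes L: "is_diagram L" and "(cell_move L)\<^sup>*\<^sup>* M D" "M \<subseteq> L"
  shows "(\<Prod>u\<in>D. hook_weight L u) \<le> (\<Prod>u\<in>M. hook_weight L u)"
  using assms(2)
proof induction
  case (step D D')
  have DL: "D \<subseteq> L" using moves_subset[OF step.hyps(1) assms(3)] .
  then have fin: "finite D" using is_diagram_finite[OF L] finite_subset by blast
  obtain i j where m: "(i, j) \<in> D" "(i + 1, j + 1) \<in> L" "(i + 1, j + 1) \<notin> D"
    "D' = insert (i + 1, j + 1) (D - {(i, j)})"
    using step.hyps(2) unfolding cell_move_def by blast
  have "(\<Prod>u\<in>D'. hook_weight L u) = hook_weight L (i + 1, j + 1) * (\<Prod>u\<in>D - {(i, j)}. hook_weight L u)"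
    unfolding m(4) using fin m(3) by (intro prod.insert) auto
  also have "\<dots> \<le> hook_weight L (i, j) * (\<Prod>u\<in>D - {(i, j)}. hook_weight L u)"
  proof (rule mult_right_mono)
    show "hook_weight L (i + 1, j + 1) \<le> hook_weight L (i, j)"
      using hook_weight_diagonal_mono[OF L] m DL by blast
    show "0 \<le> (\<Prod>u\<in>D - {(i, j)}. hook_weight L u)"
      by (rule prod_nonneg) (use hook_weight_ge_one[OF L] DL in force)
  qed
  also have "\<dots> = (\<Prod>u\<in>D. hook_weight L u)"
    by (rule prod.remove[OF fin m(1), symmetric])
  finally show ?case using step.IH by linarith
qed simp

section \<open>Translation to partitions given by their parts\<close>

lemma part_antimono:
  assumes "is_partition la" "1 \<le> i'" "i' \<le> i"
  shows "part la i \<le> part la i'"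
proof (cases "i \<le> length la \<and> i' < i")
  case True
  then have "i' - 1 < i - 1" "i - 1 < length la" using assms(2) by auto
  then have "la ! (i' - 1) \<ge> la ! (i - 1)"
    using assms sorted_wrt_nth_less[of "(\<ge>)" la "i' - 1" "i - 1"] by (simp add: is_partition_def)
  then show ?thesis using True assms by (simp add: part_def)
next
  case False
  then show ?thesis using assms by (cases "i' = i") (auto simp: part_def)
qed

lemma is_diagram_young_diagram:
  assumes "is_partition la"
  shows "is_diagram (young_diagram la)"
proof (rule is_diagramI)
  have "young_diagram la \<subseteq> (SIGMA i:{1..length la}. {1..part la i})"
    by (auto simp: young_diagram_def part_def split: if_splits)
  then show "finite (young_diagram la)" by (rule finite_subset) auto
next
  fix i j i' j'
  assume "(i, j) \<in> young_diagram la" "1 \<le> i'" "i' \<le> i" "1 \<le> j'" "j' \<le> j"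
  then show "(i', j') \<in> young_diagram la"
    using part_antimono[OF assms, of i' i] by (auto simp: young_diagram_def)
qed (auto simp: young_diagram_def)

lemma hook_weight_young_diagram:
  assumes "u \<in> young_diagram la"
  shows "hook_weight (young_diagram la) u = real_of_int (hook_length la u)"
proof -
  obtain i j where ij: "u = (i, j)" by (cases u)
  have "{j'. (i, j') \<in> young_diagram la} = {1..part la i}"
    using assms ij by (auto simp: young_diagram_def)
  then have "row_len (young_diagram la) i = part la i" by (simp add: row_len_def)
  moreover have "col_len (young_diagram la) j = conj_part la j"
    by (simp add: col_len_def conj_part_def)
  ultimately show ?thesis by (simp add: ij)
qed

theorem theorem3p3:
  fixes la mu :: "nat list"
  assumes "is_skew_shape la mu"
  shows "F_skew la mu \<le> real (num_tableaux la mu) \<and>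
    real (num_tableaux la mu) \<le> real (num_excited la mu) * F_skew la mu"
proof -
  let ?L = "young_diagram la" and ?M = "young_diagram mu"
  let ?h = "hook_weight ?L"
  have L: "is_diagram ?L" and M: "is_diagram ?M" and sub: "?M \<subseteq> ?L"
    using assms is_diagram_young_diagram by (auto simp: is_skew_shape_def)
  obtain cs where g: "growth cs" and cs: "set cs = ?L" using growth_exists[OF L] by blast
  define E where "E = excited_along cs ?M"
  define PL PM where "PL = (\<Prod>u\<in>?L. ?h u)" and "PM = (\<Prod>u\<in>?M. ?h u)"
  have pos: "0 < ?h u" if "u \<in> ?L" for u using hook_weight_ge_one[OF L that] by linarith
  have PL: "0 < PL" unfolding PL_def by (rule prod_pos) (use pos in blast)
  have finL: "finite ?L" by (rule is_diagram_finite[OF L])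
  have moves: "(cell_move ?L)\<^sup>*\<^sup>* ?M D" if "D \<in> E" for D
    using excited_along_moves[OF g M] that unfolding E_def cs by blast
  have E_sub: "E \<subseteq> excited_diagrams la mu"
    using moves by (auto simp: excited_diagrams_def excited_move_eq)
  have "excited_diagrams la mu \<subseteq> Pow ?L"
    using moves_subset[OF _ sub] by (auto simp: excited_diagrams_def excited_move_eq)
  then have "finite (excited_diagrams la mu)" using finL by (meson finite_Pow_iff finite_subset)
  then have card_E: "card E \<le> num_excited la mu"
    unfolding num_excited_def using E_sub by (rule card_mono)
  have finE: "finite E" unfolding E_def by (rule finite_excited_along[OF M])
  have naruse: "real (num_tableaux la mu) * PL = fact (card (?L - ?M)) * (\<Sum>D\<in>E. \<Prod>u\<in>D. ?h u)"
    using naruse_hook_length_formula[OF g M] sub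
    by (simp add: cs num_tableaux_def standard_tableaux_eq skew_diagram_def PL_def E_def excited_sum_def)
  have nonneg: "0 \<le> (\<Prod>u\<in>D. ?h u)" if "D \<in> E" for D
    using moves_subset[OF moves[OF that] sub] pos by (intro prod_nonneg) (meson less_imp_le subsetD)
  \<comment> \<open>The hooks over the skew shape cancel and leave those over \<mu>, so
    \<open>PM\<close> plays for \<open>F_skew\<close> the role that the sum over \<open>E\<close>
    plays for the number of tableaux.\<close>
  have F: "F_skew la mu * PL = fact (card (?L - ?M)) * PM"
  proof -
    have "(\<Prod>u\<in>?L - ?M. 1 / real_of_int (hook_length la u)) = (\<Prod>u\<in>?L - ?M. 1 / ?h u)"
      by (rule prod.cong) (auto simp: hook_weight_young_diagram)
    moreover have "PL = (\<Prod>u\<in>?L - ?M. ?h u) * PM"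
      unfolding PL_def PM_def by (rule prod.subset_diff[OF sub finL])
    moreover have "(\<Prod>u\<in>?L - ?M. ?h u) \<noteq> 0"
      using pos finL by (simp add: prod_zero_iff) (metis DiffD1 less_irrefl)
    ultimately show ?thesis
      by (simp add: F_skew_def skew_diagram_def prod_dividef)
  qed
  \<comment> \<open>The lower bound keeps only the term of \<mu>; all terms are nonnegative.\<close>
  have "?M \<in> E" unfolding E_def using self_excited_along[OF g M] sub cs by simp
  then have "PM \<le> (\<Sum>D\<in>E. \<Prod>u\<in>D. ?h u)"
    unfolding PM_def by (rule member_le_sum) (use nonneg finE in auto)
  then have "F_skew la mu * PL \<le> real (num_tableaux la mu) * PL"
    unfolding F naruse by (rule mult_left_mono) simp
  then have lower: "F_skew la mu \<le> real (num_tableaux la mu)" using PL by simp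
  \<comment> \<open>For the upper bound every term is at most \<open>PM\<close>, and there are at
    most \<open>num_excited la mu\<close> of them.\<close>
  have "(\<Sum>D\<in>E. \<Prod>u\<in>D. ?h u) \<le> (\<Sum>D\<in>E. PM)"
    unfolding PM_def by (rule sum_mono) (rule moves_prod_hook_le[OF L moves sub])
  also have "\<dots> \<le> real (num_excited la mu) * PM"
  proof -
    have "0 \<le> PM" unfolding PM_def by (rule nonneg[OF \<open>?M \<in> E\<close>])
    then show ?thesis using card_E by (simp add: mult_right_mono)
  qed
  finally have "real (num_tableaux la mu) * PL \<le> fact (card (?L - ?M)) * (real (num_excited la mu) * PM)"
    unfolding naruse by (rule mult_left_mono) simp
  also have "\<dots> = (real (num_excited la mu) * F_skew la mu) * PL"
    using F by (simp add: mult.left_commute mult.assoc)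
  finally show ?thesis using PL lower by simp
qed

end
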